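(* Consider four-dimensional Riemann-Cartan space-time manifolds $M$ with coordinates $(t,x,y,z)$, endowed with the Gödel-type metric $$ds^2=[dt+H(x)\,dy]^2-D^2(x)\,dy^2-dx^2-dz^2$$ and with the torsion whose only nonvanishing coordinate component (up to antisymmetry in the two lower indices) is $$T^t_{\ xy}=D(x)\,S(z),$$ where $H(x)$, $D(x)$, $S(z)$ are smooth real functions and $D$ is nowhere zero. Every such $M$ that is space-time locally homogeneous admits a five-dimensional group of affine-isometric motions. Moreover, these locally homogeneous manifolds are characterized by the three independent real parameters $m^2$, $\omega$, $S_0$, the constant values $$\frac{D''}{D}= m^2,\qquad \frac{H'}{D}= 2\omega,\qquad S= S_0$$ (prime denoting the derivative with respect to $x$), in the sense that identical triads $(m^2,\omega,S_0)$ specify locally equivalent manifolds.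
   Context: A Riemann-Cartan space-time manifold is a smooth four-dimensional manifold with a Lorentzian metric $g$ and a metric-compatible, not necessarily symmetric, connection $\Gamma$. The connection is determined by $g$ and the torsion tensor $T$, which is antisymmetric in its two lower indices. The coordinates range over $t,y\in\mathbb{R}$ and $x,z$ in open intervals on which the functions are defined. Equivalently, in the coframe $\omega^0=dt+H(x)\,dy$, $\omega^1=dx$, $\omega^2=D(x)\,dy$, $\omega^3=dz$, the metric is $\eta_{AB}\omega^A\omega^B$ with $\eta=\mathrm{diag}(+1,-1,-1,-1)$, and the only nonvanishing torsion component (up to antisymmetry) is $T^0_{\ 12}=S(z)$; that is, $T=S(z)\,\partial_t\otimes(\omega^1\wedge\omega^2)$. An affine-isometric motion is a (local) diffeomorphism preserving both the metric and the connection (equivalently, the metric and the torsion). Infinitesimally, it is a vector field $X$ with $\mathcal{L}_Xg=0$ and $\mathcal{L}_XT=0$. Groups of motions are understood as local groups. $M$ is space-time locally homogeneous if the orbit of every point under local affine-isometric motions has dimension $4$. For this class of manifolds, local homogeneity is equivalent to $H'/D$, $D''/D$ and $S$ all being constant, so the parameters are well defined. Two Riemann-Cartan manifolds are locally equivalent if there are local diffeomorphisms between them carrying the metric to the metric and the connection to the connection (equivalently, metric to metric and torsion to torsion). $m^2$ is the name of a real constant; no sign restriction is imposed on it. *)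

theory Defs
  imports "HOL-Analysis.Analysis"
begin

section \<open>Smooth maps\<close>

primrec times_differentiable_on ::
  "nat \<Rightarrow> 'a::real_normed_vector set \<Rightarrow> ('a \<Rightarrow> 'b::real_normed_vector) \<Rightarrow> bool" where
  "times_differentiable_on 0 U f \<longleftrightarrow> continuous_on U f"
| "times_differentiable_on (Suc n) U f \<longleftrightarrow>
     (\<forall>x\<in>U. f differentiable (at x)) \<and>
     (\<forall>v. times_differentiable_on n U (\<lambda>x. frechet_derivative f (at x) v))"

text \<open>Meaningful on open sets \<open>U\<close> only; this is the class of \<open>C\<close>-infinity maps there.\<close>

definition smooth_on ::
  "'a::real_normed_vector set \<Rightarrow> ('a \<Rightarrow> 'b::real_normed_vector) \<Rightarrow> bool" where
  "smooth_on U f \<longleftrightarrow> (\<forall>n. times_differentiable_on n U f)"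


section \<open>Riemann-Cartan structures on subsets of coordinate space\<close>

text \<open>
  A structure is given by its coordinate domain, its metric and its torsion, the metric-compatible
  connection being determined by the latter two. With \<open>p\<close> a point and \<open>u\<close>, \<open>v\<close>
  tangent vectors at \<open>p\<close> (component vectors in the coordinate frame),
  \<open>metric M p u v\<close> is the scalar with summands \<open>g_ab u^a v^b\<close>, and
  \<open>torsion M p u v\<close> is the tangent vector whose components have summands
  \<open>T^a_bc u^b v^c\<close>.
\<close>

record rc_space =
  points :: "(real^4) set"
  metric :: "real^4 \<Rightarrow> real^4 \<Rightarrow> real^4 \<Rightarrow> real"
  torsion :: "real^4 \<Rightarrow> real^4 \<Rightarrow> real^4 \<Rightarrow> real^4"

definition local_affine_isometry ::
  "rc_space \<Rightarrow> rc_space \<Rightarrow> (real^4) set \<Rightarrow> (real^4) set \<Rightarrow> (real^4 \<Rightarrow> real^4) \<Rightarrow> bool" where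
  "local_affine_isometry M N U V \<phi> \<longleftrightarrow>
     open U \<and> U \<subseteq> points M \<and> open V \<and> V \<subseteq> points N \<and>
     bij_betw \<phi> U V \<and> smooth_on U \<phi> \<and> smooth_on V (inv_into U \<phi>) \<and>
     (\<forall>p\<in>U. \<forall>u v. let d\<phi> = frechet_derivative \<phi> (at p) in
        metric N (\<phi> p) (d\<phi> u) (d\<phi> v) = metric M p u v \<and>
        torsion N (\<phi> p) (d\<phi> u) (d\<phi> v) = d\<phi> (torsion M p u v))"

definition locally_equivalent :: "rc_space \<Rightarrow> rc_space \<Rightarrow> bool" where
  "locally_equivalent M N \<longleftrightarrow>
     (\<forall>p\<in>points M. \<exists>U V \<phi>. local_affine_isometry M N U V \<phi> \<and> p \<in> U) \<and>
     (\<forall>q\<in>points N. \<exists>U V \<phi>. local_affine_isometry M N U V \<phi> \<and> q \<in> V)"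

definition motion_orbit :: "rc_space \<Rightarrow> real^4 \<Rightarrow> (real^4) set" where
  "motion_orbit M p = {\<phi> p | U V \<phi>. local_affine_isometry M M U V \<phi> \<and> p \<in> U}"

text \<open>An orbit is a submanifold; in a 4-manifold it has dimension 4 iff it is an open subset.\<close>

definition locally_homogeneous :: "rc_space \<Rightarrow> bool" where
  "locally_homogeneous M \<longleftrightarrow> (\<forall>p\<in>points M. open (motion_orbit M p))"


section \<open>Infinitesimal motions and local groups of motions\<close>

text \<open>
  The two equations say that the Lie derivatives of metric and torsion vanish, evaluated on
  constant coordinate vectors \<open>u\<close>, \<open>v\<close>. In components they are
  \<open>X^c d_c g_ab + g_cb d_a X^c + g_ac d_b X^c = 0\<close> and
  \<open>X^d d_d T^a_bc + T^a_dc d_b X^d + T^a_bd d_c X^d - T^d_bc d_d X^a = 0\<close>.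
\<close>

definition infinitesimal_motion :: "rc_space \<Rightarrow> (real^4 \<Rightarrow> real^4) \<Rightarrow> bool" where
  "infinitesimal_motion M X \<longleftrightarrow>
     smooth_on (points M) X \<and>
     (\<forall>p\<in>points M. \<forall>u v. let dX = frechet_derivative X (at p) in
        frechet_derivative (\<lambda>q. metric M q u v) (at p) (X p)
          + metric M p (dX u) v + metric M p u (dX v) = 0 \<and>
        frechet_derivative (\<lambda>q. torsion M q u v) (at p) (X p)
          + torsion M p (dX u) v + torsion M p u (dX v) - dX (torsion M p u v) = 0)"

definition lie_bracket ::
  "(real^4 \<Rightarrow> real^4) \<Rightarrow> (real^4 \<Rightarrow> real^4) \<Rightarrow> real^4 \<Rightarrow> real^4" where
  "lie_bracket X Y p =
     frechet_derivative Y (at p) (X p) - frechet_derivative X (at p) (Y p)"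

text \<open>
  By Lie's theorems, effective local actions of \<open>n\<close>-dimensional local Lie groups by
  motions of \<open>M\<close> correspond to \<open>n\<close>-dimensional Lie algebras of infinitesimal
  motions of \<open>M\<close>. The group is not required to contain every motion of \<open>M\<close>.
\<close>

definition admits_motion_group :: "rc_space \<Rightarrow> nat \<Rightarrow> bool" where
  "admits_motion_group M n \<longleftrightarrow>
     (\<exists>X :: nat \<Rightarrow> real^4 \<Rightarrow> real^4.
        (\<forall>i<n. infinitesimal_motion M (X i)) \<and>
        (\<forall>c. (\<forall>p\<in>points M. (\<Sum>i<n. c i *\<^sub>R X i p) = 0) \<longrightarrow> (\<forall>i<n. c i = 0)) \<and>
        (\<forall>i<n. \<forall>j<n. \<exists>c. \<forall>p\<in>points M.
           lie_bracket (X i) (X j) p = (\<Sum>k<n. c k *\<^sub>R X k p)))"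


section \<open>Goedel-type Riemann-Cartan space-times\<close>

text \<open>
  Coordinates \<open>(t, x, y, z)\<close> are the components \<open>p $ 1\<close>, \<open>p $ 2\<close>,
  \<open>p $ 3\<close>, \<open>p $ 4\<close>. Since \<open>4 = 0\<close> in the index type, the last one
  may also be displayed as \<open>p $ 0\<close>.
\<close>

definition goedel_rc ::
  "real set \<Rightarrow> real set \<Rightarrow> (real \<Rightarrow> real) \<Rightarrow> (real \<Rightarrow> real) \<Rightarrow> (real \<Rightarrow> real) \<Rightarrow> rc_space" where
  "goedel_rc I J H D S = \<lparr>
     points = {p. p $ 2 \<in> I \<and> p $ 4 \<in> J},
     metric = (\<lambda>p u v.
       (u $ 1 + H (p $ 2) * u $ 3) * (v $ 1 + H (p $ 2) * v $ 3)
         - (D (p $ 2))\<^sup>2 * (u $ 3 * v $ 3) - u $ 2 * v $ 2 - u $ 4 * v $ 4),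
     torsion = (\<lambda>p u v.
       (D (p $ 2) * S (p $ 4) * (u $ 2 * v $ 3 - u $ 3 * v $ 2)) *\<^sub>R axis 1 1)\<rparr>"

definition open_interval :: "real set \<Rightarrow> bool" where
  "open_interval I \<longleftrightarrow> open I \<and> is_interval I \<and> I \<noteq> {}"

definition goedel_data ::
  "real set \<Rightarrow> real set \<Rightarrow> (real \<Rightarrow> real) \<Rightarrow> (real \<Rightarrow> real) \<Rightarrow> (real \<Rightarrow> real) \<Rightarrow> bool" where
  "goedel_data I J H D S \<longleftrightarrow>
     open_interval I \<and> open_interval J \<and>
     smooth_on I H \<and> smooth_on I D \<and> smooth_on J S \<and> (\<forall>x\<in>I. D x \<noteq> 0)"

text \<open>The real number \<open>m2\<close> stands for the parameter written \<open>m^2\<close>; it may be negative.\<close>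

definition goedel_parameters ::
  "real set \<Rightarrow> real set \<Rightarrow> (real \<Rightarrow> real) \<Rightarrow> (real \<Rightarrow> real) \<Rightarrow> (real \<Rightarrow> real) \<Rightarrow>
   real \<Rightarrow> real \<Rightarrow> real \<Rightarrow> bool" where
  "goedel_parameters I J H D S m2 \<omega> S0 \<longleftrightarrow>
     (\<forall>x\<in>I. deriv (deriv D) x / D x = m2) \<and>
     (\<forall>x\<in>I. deriv H x / D x = 2 * \<omega>) \<and>
     (\<forall>z\<in>J. S z = S0)"

end

theory Submission
  imports Defs
begin

text \<open>
  Write \<open>\<Omega> = H' / D\<close>. An isometry preserves the Levi-Civita connection, hence the Ricci operator, which has
  the eigenvalue \<open>D'' / D - \<Omega>\<^sup>2 / 2\<close> in the direction \<open>\<partial>\<^sub>x\<close> and the trace \<open>2 D'' / D - \<Omega>\<^sup>2 / 2\<close>; it also preserves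
  the length \<open>\<bar>S\<bar>\<close> of the torsion. As orbits are open, these functions are locally constant, so that
  \<open>\<Omega>\<close>, \<open>D'' / D\<close> and \<open>S\<close> are constant. The Killing fields of the surface \<open>dx\<^sup>2 + D\<^sup>2 dy\<^sup>2\<close> of constant
  curvature then lift to motions, which together with \<open>\<partial>\<^sub>t\<close> and \<open>\<partial>\<^sub>z\<close> span a Lie algebra of dimension five.
  Conversely, when the three quantities are constant, any point has a chart, centred at it, in which metric
  and torsion depend on \<open>m2\<close>, \<open>\<Omega>\<close> and \<open>S\<^sub>0\<close> only. Composing such charts yields the local equivalences and
  the homogeneity of the models.
\<close>

section \<open>Smooth maps\<close>

text \<open>Equal parameters do not make \<open>H\<close> and \<open>D\<close> equal:
  \<open>D'' = m2 D\<close> leaves the initial values of \<open>D\<close> free, and the sign of the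
  constant \<open>m2 D^2 - D'^2\<close> tells apart forms such as cosh, exp and sinh, which describe
  the same surface in different coordinates. An equivalence therefore has to mix x and y. Sending
  each manifold to a common model is simpler than relating two of them directly, and the same charts
  give transitivity without integrating Killing fields. Conversely, an isometry need not respect the
  coordinate fields, and it may permute the Ricci eigenspaces. Only invariants are compared, and
  these determine \<Omega> and \<open>S\<close> up to sign; continuity on an interval restores the
  sign. All formulas cover every sign of \<open>m2\<close>, zero included, and for that reason avoid
  dividing by it.\<close>

lemma times_differentiable_on_cong:
  assumes "open U" "\<And>x. x \<in> U \<Longrightarrow> f x = g x" "times_differentiable_on n U f"
  shows "times_differentiable_on n U g"
  using assms(2,3)
proof (induction n arbitrary: f g)
  case 0
  then show ?case by (simp cong: continuous_on_cong)
next
  case (Suc n)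
  have d: "(g has_derivative frechet_derivative f (at x)) (at x)" if "x \<in> U" for x
  proof (rule has_derivative_transform_within_open[OF _ assms(1) that])
    show "(f has_derivative frechet_derivative f (at x)) (at x)"
      using Suc.prems(2) that frechet_derivative_works by auto
  qed (use Suc.prems in auto)
  then have "frechet_derivative g (at x) = frechet_derivative f (at x)" if "x \<in> U" for x
    using frechet_derivative_at that by metis
  then have "times_differentiable_on n U (\<lambda>x. frechet_derivative g (at x) v)" for v
    using Suc.IH[of "\<lambda>x. frechet_derivative f (at x) v"] Suc.prems by auto
  then show ?case using d by (auto simp: differentiable_def)
qed

lemma times_differentiable_on_SucI:
  assumes "open U" "\<And>x. x \<in> U \<Longrightarrow> (f has_derivative f' x) (at x)"
    and "\<And>v. times_differentiable_on n U (\<lambda>x. f' x v)"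
  shows "times_differentiable_on (Suc n) U f"
proof -
  have "frechet_derivative f (at x) = f' x" if "x \<in> U" for x
    using frechet_derivative_at assms(2) that by metis
  then have "times_differentiable_on n U (\<lambda>x. frechet_derivative f (at x) v)" for v
    by (intro times_differentiable_on_cong[OF assms(1) _ assms(3)[of v]]) auto
  then show ?thesis using assms(2) by (auto simp: differentiable_def)
qed

lemma times_differentiable_on_SucD:
  "times_differentiable_on (Suc n) U f \<Longrightarrow> times_differentiable_on n U f"
proof (induction n arbitrary: f)
  case 0
  then show ?case
    by (auto intro!: continuous_at_imp_continuous_on differentiable_imp_continuous_within)
next
  case (Suc n)
  then show ?case by (metis times_differentiable_on.simps(2))
qed

lemma has_derivative_frechet:
  "times_differentiable_on (Suc n) U f \<Longrightarrow> x \<in> U \<Longrightarrow> 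
    (f has_derivative frechet_derivative f (at x)) (at x)"
  using frechet_derivative_works by auto

lemma times_differentiable_on_const: "open U \<Longrightarrow> times_differentiable_on n U (\<lambda>x. c)"
proof (induction n arbitrary: c)
  case (Suc n)
  then show ?case by (intro times_differentiable_on_SucI[where f' = "\<lambda>x v. 0"]) auto
qed auto

lemma times_differentiable_on_bounded_linear:
  assumes "open U" "bounded_linear L" "times_differentiable_on n U f"
  shows "times_differentiable_on n U (\<lambda>x. L (f x))"
  using assms(3)
proof (induction n arbitrary: f)
  case 0
  then show ?case using bounded_linear.continuous_on[OF assms(2)] by simp
next
  case (Suc n)
  then show ?case
    by (intro times_differentiable_on_SucI[OF assms(1),
            where f' = "\<lambda>x v. L (frechet_derivative f (at x) v)"]
          bounded_linear.has_derivative[OF assms(2)] has_derivative_frechet) auto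
qed

lemma times_differentiable_on_add:
  assumes "open U" "times_differentiable_on n U f" "times_differentiable_on n U g"
  shows "times_differentiable_on n U (\<lambda>x. f x + g x)"
  using assms(2,3)
proof (induction n arbitrary: f g)
  case 0
  then show ?case by (auto intro: continuous_on_add)
next
  case (Suc n)
  then show ?case
    by (intro times_differentiable_on_SucI[OF assms(1),
            where f' = "\<lambda>x v. frechet_derivative f (at x) v + frechet_derivative g (at x) v"]
          has_derivative_add has_derivative_frechet) auto
qed

lemma times_differentiable_on_sum:
  assumes "open U" "\<And>i. i \<in> I \<Longrightarrow> times_differentiable_on n U (f i)"
  shows "times_differentiable_on n U (\<lambda>x. \<Sum>i\<in>I. f i x)"
  using assms(2)
  by (induction I rule: infinite_finite_induct)
    (auto simp: times_differentiable_on_const assms(1) times_differentiable_on_add)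

lemma times_differentiable_on_bilinear:
  assumes "open U" "bounded_bilinear B"
    and "times_differentiable_on n U f" "times_differentiable_on n U g"
  shows "times_differentiable_on n U (\<lambda>x. B (f x) (g x))"
  using assms(3,4)
proof (induction n arbitrary: f g)
  case 0
  then show ?case by (auto intro: bounded_bilinear.continuous_on[OF assms(2)])
next
  case (Suc n)
  show ?case
  proof (rule times_differentiable_on_SucI[OF assms(1)])
    show "((\<lambda>x. B (f x) (g x)) has_derivative (\<lambda>v. B (f x) (frechet_derivative g (at x) v) +
        B (frechet_derivative f (at x) v) (g x))) (at x)" if "x \<in> U" for x
      using Suc.prems that
      by (intro bounded_bilinear.FDERIV[OF assms(2)] has_derivative_frechet) auto
    show "times_differentiable_on n U (\<lambda>x. B (f x) (frechet_derivative g (at x) v) +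
        B (frechet_derivative f (at x) v) (g x))" for v
      using Suc.prems times_differentiable_on_SucD[OF Suc.prems(1)]
        times_differentiable_on_SucD[OF Suc.prems(2)]
      by (intro times_differentiable_on_add Suc.IH assms) auto
  qed
qed

text \<open>The definition differentiates along fixed directions, but the chain rule applies the
  derivative of \<open>f\<close> to a direction that moves with \<open>x\<close>. Expanding that
  direction in \<open>Basis\<close> restores fixed ones, with differentiable coefficients; hence the
  Euclidean middle space.\<close>

lemma times_differentiable_on_compose:
  fixes f :: "'b::euclidean_space \<Rightarrow> 'c::real_normed_vector"
  assumes "open U" and "times_differentiable_on n V f" "times_differentiable_on n U g"
    and "g ` U \<subseteq> V"
  shows "times_differentiable_on n U (\<lambda>x. f (g x))"
  using assms(2,3)
proof (induction n arbitrary: f)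
  case 0
  then show ?case using assms(4) by (auto intro: continuous_on_compose2)
next
  case (Suc n)
  have df: "(f has_derivative frechet_derivative f (at (g x))) (at (g x))" if "x \<in> U" for x
    using has_derivative_frechet[OF Suc.prems(1)] assms(4) that by auto
  show ?case
  proof (rule times_differentiable_on_SucI[OF assms(1)])
    show "((\<lambda>x. f (g x)) has_derivative (\<lambda>v. \<Sum>i\<in>Basis. (frechet_derivative g (at x) v \<bullet> i) *\<^sub>R
        frechet_derivative f (at (g x)) i)) (at x)" if "x \<in> U" for x
    proof -
      interpret L: linear "frechet_derivative f (at (g x))"
        using has_derivative_linear[OF df[OF that]] .
      have expand: "frechet_derivative f (at (g x)) w =
        (\<Sum>i\<in>Basis. (w \<bullet> i) *\<^sub>R frechet_derivative f (at (g x)) i)" for w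
        by (subst euclidean_representation[of w, symmetric]) (simp only: L.sum L.scaleR)
      show ?thesis
        by (rule has_derivative_eq_rhs[OF has_derivative_compose[OF
                has_derivative_frechet[OF Suc.prems(2) that] df[OF that]]])
          (rule ext, rule expand)
    qed
    show "times_differentiable_on n U (\<lambda>x. \<Sum>i\<in>Basis. (frechet_derivative g (at x) v \<bullet> i) *\<^sub>R
        frechet_derivative f (at (g x)) i)" for v
      using Suc.prems times_differentiable_on_SucD[OF Suc.prems(2)]
      by (intro times_differentiable_on_sum times_differentiable_on_bilinear[OF _ bounded_bilinear_scaleR]
            times_differentiable_on_bounded_linear[OF _ bounded_linear_inner_left] Suc.IH assms(1)) auto
  qed
qed

lemma smooth_on_iff:
  "smooth_on U f \<longleftrightarrow>
    (\<forall>x\<in>U. f differentiable (at x)) \<and> (\<forall>v. smooth_on U (\<lambda>x. frechet_derivative f (at x) v))"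
  (is "?l \<longleftrightarrow> ?r")
proof
  show "?l \<Longrightarrow> ?r"
    unfolding smooth_on_def by (metis times_differentiable_on.simps(2))
  assume r: ?r
  have "times_differentiable_on n U f" for n
  proof (cases n)
    case 0
    then show ?thesis using r
      by (auto intro!: continuous_at_imp_continuous_on differentiable_imp_continuous_within)
  qed (use r in \<open>auto simp: smooth_on_def\<close>)
  then show ?l by (auto simp: smooth_on_def)
qed

lemma smooth_on_cong:
  assumes "open U" "\<And>x. x \<in> U \<Longrightarrow> f x = g x"
  shows "smooth_on U f \<longleftrightarrow> smooth_on U g"
  using times_differentiable_on_cong[OF assms(1), of f g]
    times_differentiable_on_cong[OF assms(1), of g f] assms(2)
  by (auto simp: smooth_on_def)

lemma smooth_onI:
  assumes "open U" "\<And>x. x \<in> U \<Longrightarrow> (f has_derivative f' x) (at x)"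
    and "\<And>v. smooth_on U (\<lambda>x. f' x v)"
  shows "smooth_on U f"
proof -
  have "frechet_derivative f (at x) = f' x" if "x \<in> U" for x
    using frechet_derivative_at assms(2) that by metis
  then have "smooth_on U (\<lambda>x. frechet_derivative f (at x) v)" for v
    using smooth_on_cong[OF assms(1), of "\<lambda>x. frechet_derivative f (at x) v"] assms(3) by auto
  then show ?thesis
    using assms(2) by (subst smooth_on_iff) (auto simp: differentiable_def)
qed

lemma smooth_on_has_derivative:
  "smooth_on U f \<Longrightarrow> x \<in> U \<Longrightarrow> (f has_derivative frechet_derivative f (at x)) (at x)"
  using smooth_on_iff frechet_derivative_works by blast

lemma smooth_on_frechet_derivative:
  "smooth_on U f \<Longrightarrow> smooth_on U (\<lambda>x. frechet_derivative f (at x) v)"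
  using smooth_on_iff by blast

lemma smooth_on_continuous_on: "smooth_on U f \<Longrightarrow> continuous_on U f"
  unfolding smooth_on_def by (metis times_differentiable_on.simps(1))

lemma times_differentiable_on_subset:
  "times_differentiable_on n U f \<Longrightarrow> V \<subseteq> U \<Longrightarrow> times_differentiable_on n V f"
  by (induction n arbitrary: f) (auto intro: continuous_on_subset)

lemma smooth_on_subset: "smooth_on U f \<Longrightarrow> V \<subseteq> U \<Longrightarrow> smooth_on V f"
  unfolding smooth_on_def using times_differentiable_on_subset by blast

named_theorems smooth_intros

lemma smooth_on_const [smooth_intros]: "open U \<Longrightarrow> smooth_on U (\<lambda>x. c)"
  by (simp add: smooth_on_def times_differentiable_on_const)

lemma smooth_on_id [smooth_intros]: "open U \<Longrightarrow> smooth_on U (\<lambda>x. x)"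
  by (rule smooth_onI[where f' = "\<lambda>x v. v"]) (auto intro: smooth_on_const)

lemma smooth_on_bounded_linear:
  "open U \<Longrightarrow> bounded_linear L \<Longrightarrow> smooth_on U f \<Longrightarrow> smooth_on U (\<lambda>x. L (f x))"
  by (simp add: smooth_on_def times_differentiable_on_bounded_linear)

lemma smooth_on_bilinear:
  "open U \<Longrightarrow> bounded_bilinear B \<Longrightarrow> smooth_on U f \<Longrightarrow> smooth_on U g
    \<Longrightarrow> smooth_on U (\<lambda>x. B (f x) (g x))"
  by (simp add: smooth_on_def times_differentiable_on_bilinear)

lemma smooth_on_compose:
  fixes f :: "'b::euclidean_space \<Rightarrow> 'c::real_normed_vector"
  shows "open U \<Longrightarrow> smooth_on V f \<Longrightarrow> smooth_on U g \<Longrightarrow> g ` U \<subseteq> V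
    \<Longrightarrow> smooth_on U (\<lambda>x. f (g x))"
  by (auto simp: smooth_on_def intro: times_differentiable_on_compose)

lemma smooth_on_add [smooth_intros]:
  "open U \<Longrightarrow> smooth_on U f \<Longrightarrow> smooth_on U g \<Longrightarrow> smooth_on U (\<lambda>x. f x + g x)"
  by (simp add: smooth_on_def times_differentiable_on_add)

lemma smooth_on_minus [smooth_intros]:
  "open U \<Longrightarrow> smooth_on U f \<Longrightarrow> smooth_on U (\<lambda>x. - f x)"
  by (rule smooth_on_bounded_linear[OF _ bounded_linear_minus[OF bounded_linear_ident]])

lemma smooth_on_diff [smooth_intros]:
  "open U \<Longrightarrow> smooth_on U f \<Longrightarrow> smooth_on U g \<Longrightarrow> smooth_on U (\<lambda>x. f x - g x)"
  using smooth_on_add[OF _ _ smooth_on_minus, of U f g] by simp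

lemmas smooth_on_scaleR [smooth_intros] = smooth_on_bilinear[OF _ bounded_bilinear_scaleR]

lemma smooth_on_mult [smooth_intros]:
  fixes f :: "_ \<Rightarrow> 'a::real_normed_algebra"
  shows "open U \<Longrightarrow> smooth_on U f \<Longrightarrow> smooth_on U g \<Longrightarrow> smooth_on U (\<lambda>x. f x * g x)"
  by (rule smooth_on_bilinear[OF _ bounded_bilinear_mult])

lemma smooth_on_power [smooth_intros]:
  fixes f :: "_ \<Rightarrow> 'a::real_normed_algebra_1"
  shows "open U \<Longrightarrow> smooth_on U f \<Longrightarrow> smooth_on U (\<lambda>x. f x ^ n)"
  by (induction n) (auto intro: smooth_intros)

lemma smooth_on_vec_nth [smooth_intros]:
  "open U \<Longrightarrow> smooth_on U f \<Longrightarrow> smooth_on U (\<lambda>x. f x $ i)"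
  by (rule smooth_on_bounded_linear[OF _ bounded_linear_vec_nth])

text \<open>The derivative is a polynomial in \<open>inverse\<close> itself, so the order of
  differentiability carries itself from \<open>n\<close> to \<open>Suc n\<close>.\<close>

lemma smooth_on_inverse_real: "smooth_on (- {0}) (inverse :: real \<Rightarrow> real)"
proof -
  have "times_differentiable_on n (- {0}) (inverse :: real \<Rightarrow> real)" for n
  proof (induction n)
    case 0
    then show ?case by (auto intro!: continuous_intros)
  next
    case (Suc n)
    show ?case
    proof (rule times_differentiable_on_SucI)
      show "((inverse :: real \<Rightarrow> real) has_derivative (\<lambda>v. - (inverse x * v * inverse x))) (at x)"
        if "x \<in> - {0}" for x
        using that by (auto intro!: derivative_eq_intros)
      show "times_differentiable_on n (- {0}) (\<lambda>x. - (inverse x * v * inverse x))" for v :: real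
        by (intro times_differentiable_on_bounded_linear[OF _ bounded_linear_minus[OF bounded_linear_ident]]
              times_differentiable_on_bilinear[OF _ bounded_bilinear_mult] times_differentiable_on_const Suc)
          auto
    qed auto
  qed
  then show ?thesis by (auto simp: smooth_on_def)
qed

lemma smooth_on_divide [smooth_intros]:
  fixes f g :: "_ \<Rightarrow> real"
  assumes "open U" "smooth_on U f" "smooth_on U g" "\<And>x. x \<in> U \<Longrightarrow> g x \<noteq> 0"
  shows "smooth_on U (\<lambda>x. f x / g x)"
  using smooth_on_mult[OF assms(1,2) smooth_on_compose[OF assms(1) smooth_on_inverse_real assms(3)]]
    assms(4) by (force simp: divide_inverse)

lemma smooth_on_deriv:
  fixes f :: "real \<Rightarrow> real"
  assumes "open U" "smooth_on U f"
  shows "x \<in> U \<Longrightarrow> (f has_real_derivative deriv f x) (at x)" "smooth_on U (deriv f)"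
proof -
  show d: "(f has_real_derivative deriv f x) (at x)" if "x \<in> U" for x
  proof -
    have "f differentiable at x" using assms that smooth_on_iff by blast
    then show ?thesis
      using field_differentiable_derivI field_differentiable_def
      by (metis DERIV_deriv_iff_real_differentiable)
  qed
  then have "frechet_derivative f (at x) 1 = deriv f x" if "x \<in> U" for x
    using that frechet_derivative_at[of f] by (metis has_field_derivative_def mult.right_neutral)
  then show "smooth_on U (deriv f)"
    using smooth_on_cong[OF assms(1), of "\<lambda>x. frechet_derivative f (at x) 1" "deriv f"]
      smooth_on_frechet_derivative[OF assms(2)] by auto
qed

section \<open>Symmetry of second derivatives, the Poincare lemma and smooth local inverses\<close>

lemma second_difference_mean_value:
  fixes f :: "'a::real_normed_vector \<Rightarrow> real"
  assumes sm: "smooth_on U f" and "0 < h"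
    and box: "\<And>s t. 0 \<le> s \<Longrightarrow> s \<le> h \<Longrightarrow> 0 \<le> t \<Longrightarrow> t \<le> h \<Longrightarrow> x + s *\<^sub>R u + t *\<^sub>R v \<in> U"
  obtains s t where "0 < s" "s < h" "0 < t" "t < h"
    "f (x + h *\<^sub>R u + h *\<^sub>R v) - f (x + h *\<^sub>R u) - f (x + h *\<^sub>R v) + f x =
      h\<^sup>2 * frechet_derivative (\<lambda>y. frechet_derivative f (at y) u) (at (x + s *\<^sub>R u + t *\<^sub>R v)) v"
proof -
  define fu where "fu = (\<lambda>y. frechet_derivative f (at y) u)"
  have smu: "smooth_on U fu" unfolding fu_def by (rule smooth_on_frechet_derivative[OF sm])
  have line: "((\<lambda>s. g (a + s *\<^sub>R w)) has_real_derivative frechet_derivative g (at (a + s *\<^sub>R w)) w) (at s)"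
    if "smooth_on U g" "a + s *\<^sub>R w \<in> U" for g :: "'a \<Rightarrow> real" and a w s
  proof -
    have d: "(g has_derivative frechet_derivative g (at (a + s *\<^sub>R w))) (at (a + s *\<^sub>R w))"
      by (rule smooth_on_has_derivative[OF that])
    have "((\<lambda>s. a + s *\<^sub>R w) has_derivative (\<lambda>r. r *\<^sub>R w)) (at s)"
      by (auto intro!: derivative_eq_intros)
    from has_derivative_compose[OF this d] show ?thesis
      unfolding has_field_derivative_def
      by (rule has_derivative_eq_rhs)
        (simp add: linear_cmul[OF has_derivative_linear[OF d]] fun_eq_iff)
  qed
  define \<psi> where "\<psi> s = f (x + h *\<^sub>R v + s *\<^sub>R u) - f (x + s *\<^sub>R u)" for s
  have "\<exists>z>0. z < h \<and> \<psi> h - \<psi> 0 = (h - 0) * (fu (x + h *\<^sub>R v + z *\<^sub>R u) - fu (x + z *\<^sub>R u))"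
  proof (rule MVT2[OF \<open>0 < h\<close>])
    fix s assume s: "0 \<le> s" "s \<le> h"
    show "(\<psi> has_real_derivative fu (x + h *\<^sub>R v + s *\<^sub>R u) - fu (x + s *\<^sub>R u)) (at s)"
      unfolding \<psi>_def fu_def using box[of s h] box[of s 0] s
      by (intro DERIV_diff line sm) (auto simp: algebra_simps)
  qed
  then obtain s where s: "0 < s" "s < h"
    "\<psi> h - \<psi> 0 = h * (fu (x + h *\<^sub>R v + s *\<^sub>R u) - fu (x + s *\<^sub>R u))" by auto
  have "\<exists>z>0. z < h \<and> fu (x + s *\<^sub>R u + h *\<^sub>R v) - fu (x + s *\<^sub>R u + 0 *\<^sub>R v) =
      (h - 0) * frechet_derivative fu (at (x + s *\<^sub>R u + z *\<^sub>R v)) v"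
    by (rule MVT2[OF \<open>0 < h\<close>], rule line[OF smu]) (use box s in auto)
  then obtain t where t: "0 < t" "t < h" "fu (x + s *\<^sub>R u + h *\<^sub>R v) - fu (x + s *\<^sub>R u) =
      h * frechet_derivative fu (at (x + s *\<^sub>R u + t *\<^sub>R v)) v" by auto
  show ?thesis
    by (rule that[OF s(1,2) t(1,2)])
      (use s(3) t(3) in \<open>simp add: \<psi>_def fu_def algebra_simps power2_eq_square\<close>)
qed

text \<open>The second difference of \<open>f\<close> over a small parallelogram does not depend on
  the order of \<open>u\<close> and \<open>v\<close>, while the mean value theorem, applied once in
  each direction, writes it as \<open>h\<^sup>2\<close> times either mixed derivative at some nearby
  point. Continuity of both then rules out different values at \<open>x\<close>.\<close>

lemma smooth_on_symmetric_real:
  fixes f :: "'a::real_normed_vector \<Rightarrow> real"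
  assumes "open U" "smooth_on U f" "x \<in> U"
  shows "frechet_derivative (\<lambda>y. frechet_derivative f (at y) u) (at x) v =
    frechet_derivative (\<lambda>y. frechet_derivative f (at y) v) (at x) u"
proof (rule ccontr)
  define F where "F u v y = frechet_derivative (\<lambda>y. frechet_derivative f (at y) u) (at y) v" for u v y
  assume "\<not> ?thesis"
  then have ne: "F u v x \<noteq> F v u x" by (simp add: F_def)
  have "continuous_on U (F a b)" for a b
    unfolding F_def using assms(2) by (intro smooth_on_continuous_on smooth_on_frechet_derivative)
  then have c: "isCont (F a b) x" for a b
    using assms continuous_on_eq_continuous_at by blast
  define e where "e = \<bar>F u v x - F v u x\<bar> / 2"
  have "e > 0" using ne by (simp add: e_def)
  then obtain d1 where d1: "d1 > 0" "\<And>y. dist y x < d1 \<Longrightarrow> dist (F u v y) (F u v x) < e"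
    using c[of u v] unfolding continuous_at_eps_delta by blast
  obtain d2 where d2: "d2 > 0" "\<And>y. dist y x < d2 \<Longrightarrow> dist (F v u y) (F v u x) < e"
    using c[of v u] \<open>e > 0\<close> unfolding continuous_at_eps_delta by blast
  obtain d3 where d3: "d3 > 0" "ball x d3 \<subseteq> U" using assms open_contains_ball by blast
  define d where "d = min d1 (min d2 d3)"
  have d: "d > 0" using d1 d2 d3 by (simp add: d_def)
  \<comment> \<open>Small enough for all points of both parallelograms to lie within
    \<open>d\<close> of \<open>x\<close>; the summand 1 keeps the denominator positive when
    \<open>u\<close> and \<open>v\<close> vanish.\<close>
  define h where "h = d / (2 * (norm u + norm v + 1))"
  have N: "norm u + norm v + 1 > 0" by (smt (verit) norm_ge_zero)
  have h: "h > 0" unfolding h_def using d N by simp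
  have near: "dist (x + s *\<^sub>R a + t *\<^sub>R b) x < d"
    if "0 \<le> s" "s \<le> h" "0 \<le> t" "t \<le> h" "norm a + norm b = norm u + norm v" for s t a b
  proof -
    have "dist (x + s *\<^sub>R a + t *\<^sub>R b) x = norm (s *\<^sub>R a + t *\<^sub>R b)" by (simp add: dist_norm)
    also have "\<dots> \<le> s * norm a + t * norm b"
      using norm_triangle_ineq[of "s *\<^sub>R a" "t *\<^sub>R b"] that by simp
    also have "\<dots> \<le> h * norm a + h * norm b"
      using that by (intro add_mono mult_right_mono) auto
    also have "\<dots> = h * (norm u + norm v)" using that(5) by (metis distrib_left)
    also have "\<dots> < h * (2 * (norm u + norm v + 1))"
      by (rule mult_strict_left_mono[OF _ h]) (smt (verit) norm_ge_zero)
    also have "\<dots> = d" using N by (simp add: h_def)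
    finally show ?thesis .
  qed
  have box: "x + s *\<^sub>R a + t *\<^sub>R b \<in> U"
    if "0 \<le> s" "s \<le> h" "0 \<le> t" "t \<le> h" "norm a + norm b = norm u + norm v" for s t a b
    using near[OF that] d3 by (auto simp: d_def dist_commute subset_eq)
  define \<Delta> where "\<Delta> = f (x + h *\<^sub>R u + h *\<^sub>R v) - f (x + h *\<^sub>R u) - f (x + h *\<^sub>R v) + f x"
  obtain s t where st: "0 < s" "s < h" "0 < t" "t < h" "\<Delta> = h\<^sup>2 * F u v (x + s *\<^sub>R u + t *\<^sub>R v)"
    by (rule second_difference_mean_value[OF assms(2) h, of x u v]) (auto simp: box \<Delta>_def F_def)
  obtain s' t' where st': "0 < s'" "s' < h" "0 < t'" "t' < h" "\<Delta> = h\<^sup>2 * F v u (x + s' *\<^sub>R v + t' *\<^sub>R u)"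
  proof (rule second_difference_mean_value[OF assms(2) h, of x v u])
    show "x + s *\<^sub>R v + t *\<^sub>R u \<in> U" if "0 \<le> s" "s \<le> h" "0 \<le> t" "t \<le> h" for s t
      using that by (intro box) auto
  qed (auto simp: \<Delta>_def F_def add.commute add.left_commute)
  have "F u v (x + s *\<^sub>R u + t *\<^sub>R v) = F v u (x + s' *\<^sub>R v + t' *\<^sub>R u)"
    using st(5) st'(5) h by simp
  moreover have "dist (F u v (x + s *\<^sub>R u + t *\<^sub>R v)) (F u v x) < e"
    using near[of s t u v] st by (intro d1) (auto simp: d_def)
  moreover have "dist (F v u (x + s' *\<^sub>R v + t' *\<^sub>R u)) (F v u x) < e"
    using near[of s' t' v u] st' by (intro d2) (auto simp: d_def)
  ultimately show False unfolding e_def dist_real_def by (smt (verit) field_sum_of_halves)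
qed

lemma smooth_on_symmetric:
  fixes f :: "'a::real_normed_vector \<Rightarrow> 'b::euclidean_space"
  assumes U: "open U" and f: "smooth_on U f" and x: "x \<in> U"
  shows "frechet_derivative (\<lambda>y. frechet_derivative f (at y) u) (at x) v =
    frechet_derivative (\<lambda>y. frechet_derivative f (at y) v) (at x) u"
proof (rule euclidean_eqI)
  fix i :: 'b assume "i \<in> Basis"
  have *: "frechet_derivative (\<lambda>y. g y \<bullet> i) (at y) w = frechet_derivative g (at y) w \<bullet> i"
    if "smooth_on U g" "y \<in> U" for g :: "'a \<Rightarrow> 'b" and y w
    by (subst frechet_derivative_at[symmetric,
          OF has_derivative_inner_left[OF smooth_on_has_derivative[OF that]]]) simp
  have **: "frechet_derivative (\<lambda>y. frechet_derivative (\<lambda>y. f y \<bullet> i) (at y) u) (at x) v =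
      frechet_derivative (\<lambda>y. frechet_derivative f (at y) u) (at x) v \<bullet> i" for u v
  proof -
    have "((\<lambda>y. frechet_derivative f (at y) u \<bullet> i) has_derivative
        (\<lambda>v. frechet_derivative (\<lambda>y. frechet_derivative f (at y) u) (at x) v \<bullet> i)) (at x)"
      by (rule has_derivative_inner_left[OF smooth_on_has_derivative[OF _ x]])
        (rule smooth_on_frechet_derivative[OF f])
    then have "((\<lambda>y. frechet_derivative (\<lambda>y. f y \<bullet> i) (at y) u) has_derivative
        (\<lambda>v. frechet_derivative (\<lambda>y. frechet_derivative f (at y) u) (at x) v \<bullet> i)) (at x)"
      by (rule has_derivative_transform_within_open[OF _ U x]) (simp add: *[OF f])
    then show ?thesis using frechet_derivative_at by metis
  qed
  show "frechet_derivative (\<lambda>y. frechet_derivative f (at y) u) (at x) v \<bullet> i =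
    frechet_derivative (\<lambda>y. frechet_derivative f (at y) v) (at x) u \<bullet> i"
    unfolding **[symmetric]
    by (rule smooth_on_symmetric_real[OF U _ x])
      (rule smooth_on_bounded_linear[OF U bounded_linear_inner_left f])
qed

text \<open>The potential is the integral of the form \<open>F x \<bullet> v\<close> along the
  segment from \<open>p\<close> to \<open>x\<close>, which convexity keeps inside \<open>W\<close>.
  The hypothesis \<open>closed\<close> is the vanishing of the exterior derivative of this
  form.\<close>

lemma poincare_lemma_convex:
  fixes F :: "'a::euclidean_space \<Rightarrow> 'a"
  assumes W: "open W" "convex W" "p \<in> W" and F: "smooth_on W F"
    and closed: "\<And>x u v. x \<in> W \<Longrightarrow>
      frechet_derivative F (at x) u \<bullet> v = frechet_derivative F (at x) v \<bullet> u"
  obtains \<sigma> where "\<sigma> p = (0::real)" "\<And>x. x \<in> W \<Longrightarrow> (\<sigma> has_derivative (\<lambda>v. F x \<bullet> v)) (at x)"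
proof -
  define F' where "F' x = frechet_derivative F (at x)" for x
  have F': "(F has_derivative F' x) (at x)" if "x \<in> W" for x
    unfolding F'_def by (rule smooth_on_has_derivative[OF F that])
  have cF: "continuous_on W F" by (rule smooth_on_continuous_on[OF F])
  have cF': "continuous_on W (\<lambda>x. F' x v)" for v
    unfolding F'_def by (rule smooth_on_continuous_on[OF smooth_on_frechet_derivative[OF F]])
  have seg: "p + t *\<^sub>R (x - p) \<in> W" if "x \<in> W" "t \<in> cbox 0 1" for x and t :: real
    using convexD_alt[OF W(2,3) that(1), of t] that(2) by (simp add: algebra_simps)
  define g where "g x t = F (p + t *\<^sub>R (x - p)) \<bullet> (x - p)" for x and t :: real
  define g' where "g' x t v = F' (p + t *\<^sub>R (x - p)) (t *\<^sub>R v) \<bullet> (x - p) + F (p + t *\<^sub>R (x - p)) \<bullet> v"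
    for x and t :: real and v
  have g': "((\<lambda>x. g x t) has_derivative g' x t) (at x)" if "x \<in> W" "t \<in> cbox 0 1" for x t
  proof -
    have "((\<lambda>x. p + t *\<^sub>R (x - p)) has_derivative (\<lambda>v. t *\<^sub>R v)) (at x)"
      by (auto intro!: derivative_eq_intros)
    from has_derivative_compose[OF this F'[OF seg[OF that]]]
    have "((\<lambda>x. F (p + t *\<^sub>R (x - p))) has_derivative (\<lambda>v. F' (p + t *\<^sub>R (x - p)) (t *\<^sub>R v))) (at x)" .
    then show ?thesis unfolding g_def g'_def
      by (auto intro!: derivative_eq_intros ext)
  qed
  then have bl: "bounded_linear (g' x t)" if "x \<in> W" "t \<in> cbox 0 1" for x t
    using has_derivative_bounded_linear that by blast
  define G where "G x t = Blinfun (g' x t)" for x t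
  have G: "blinfun_apply (G x t) = g' x t" if "x \<in> W" "t \<in> cbox 0 1" for x t
    unfolding G_def using bl[OF that] by (rule bounded_linear_Blinfun_apply)
  have G_eq: "g' x t v = t *\<^sub>R (F' (p + t *\<^sub>R (x - p)) v \<bullet> (x - p)) + F (p + t *\<^sub>R (x - p)) \<bullet> v"
    if "x \<in> W" "t \<in> cbox 0 1" for x t v
    unfolding g'_def using linear_cmul[OF has_derivative_linear[OF F'[OF seg[OF that]]]] by simp
  have contG: "continuous_on (W \<times> cbox 0 1) (\<lambda>(x, t). G x t)"
  proof (rule continuous_on_blinfun_componentwise)
    fix i :: 'a
    have "continuous_on (W \<times> cbox 0 1) (\<lambda>z. snd z *\<^sub>R (F' (p + snd z *\<^sub>R (fst z - p)) i \<bullet> (fst z - p)) +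
        F (p + snd z *\<^sub>R (fst z - p)) \<bullet> i)"
      by (intro continuous_intros continuous_on_compose2[OF cF] continuous_on_compose2[OF cF'])
        (use seg in auto)
    then show "continuous_on (W \<times> cbox 0 1) (\<lambda>z. blinfun_apply (case z of (x, t) \<Rightarrow> G x t) i)"
      by (rule continuous_on_eq) (auto simp: G G_eq)
  qed
  have int: "g x integrable_on cbox 0 1" if "x \<in> W" for x
    unfolding g_def
    by (intro integrable_continuous continuous_intros continuous_on_compose2[OF cF])
      (use seg[OF that] in auto)
  define \<sigma> where "\<sigma> x = integral (cbox 0 1) (g x)" for x
  have "(\<sigma> has_derivative (\<lambda>v. F x \<bullet> v)) (at x)" if x: "x \<in> W" for x
  proof -
    have "(\<sigma> has_derivative blinfun_apply (integral (cbox 0 1) (G x))) (at x within W)"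
      unfolding \<sigma>_def
    proof (rule leibniz_rule[OF _ int contG x W(2)])
      fix y and t :: real assume "y \<in> W" "t \<in> cbox 0 1"
      then show "((\<lambda>x. g x t) has_derivative blinfun_apply (G y t)) (at y within W)"
        using g' G has_derivative_at_withinI by metis
    qed
    moreover have "blinfun_apply (integral (cbox 0 1) (G x)) v = F x \<bullet> v" for v
    proof -
      have cG: "continuous_on (cbox 0 1) (G x)"
        using continuous_on_compose2[OF contG, of "cbox 0 1" "\<lambda>t. (x, t)"] x
        by (simp add: continuous_on_Pair image_subset_iff)
      have "blinfun_apply (integral (cbox 0 1) (G x)) v = integral (cbox 0 1) (\<lambda>t. blinfun_apply (G x t) v)"
        by (rule blinfun_apply_integral) (rule integrable_continuous[OF cG])
      also have "\<dots> = integral (cbox 0 1) (\<lambda>t. t *\<^sub>R (F' (p + t *\<^sub>R (x - p)) (x - p) \<bullet> v)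
          + F (p + t *\<^sub>R (x - p)) \<bullet> v)"
        using closed[OF seg[OF x]] by (intro integral_cong) (simp add: G[OF x] G_eq[OF x] F'_def)
      \<comment> \<open>Thanks to \<open>closed\<close> the integrand is now the derivative in
        \<open>t\<close> of \<open>t\<close> times
        \<open>F (p + t *\<^sub>R (x - p)) \<bullet> v\<close>, so only the endpoint 1
        contributes.\<close>
      also have "\<dots> = 1 *\<^sub>R (F (p + 1 *\<^sub>R (x - p)) \<bullet> v) - 0 *\<^sub>R (F (p + 0 *\<^sub>R (x - p)) \<bullet> v)"
      proof (rule integral_unique, unfold cbox_interval, rule fundamental_theorem_of_calculus)
        fix t :: real assume t: "t \<in> {0..1}"
        have "((\<lambda>t. p + t *\<^sub>R (x - p)) has_derivative (\<lambda>r. r *\<^sub>R (x - p))) (at t within {0..1})"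
          by (auto intro!: derivative_eq_intros)
        from has_derivative_compose[OF this F'[OF seg[OF x, of t]]] t
        have "((\<lambda>t. F (p + t *\<^sub>R (x - p))) has_derivative (\<lambda>r. F' (p + t *\<^sub>R (x - p)) (r *\<^sub>R (x - p))))
            (at t within {0..1})" by simp
        then have "((\<lambda>t. F (p + t *\<^sub>R (x - p))) has_vector_derivative F' (p + t *\<^sub>R (x - p)) (x - p))
            (at t within {0..1})"
          unfolding has_vector_derivative_def
          using linear_cmul[OF has_derivative_linear[OF F'[OF seg[OF x, of t]]]] t by simp
        then show "((\<lambda>t. t *\<^sub>R (F (p + t *\<^sub>R (x - p)) \<bullet> v)) has_vector_derivative
            t *\<^sub>R (F' (p + t *\<^sub>R (x - p)) (x - p) \<bullet> v) + F (p + t *\<^sub>R (x - p)) \<bullet> v) (at t within {0..1})"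
          unfolding has_vector_derivative_def
          by (auto intro!: derivative_eq_intros simp: algebra_simps)
      qed simp
      finally show ?thesis by simp
    qed
    ultimately have "(\<sigma> has_derivative (\<lambda>v. F x \<bullet> v)) (at x within W)"
      by (metis (no_types, lifting) has_derivative_eq_rhs ext)
    then show ?thesis using at_within_open[OF x W(1)] by simp
  qed
  moreover have "g p = (\<lambda>t. 0)" by (simp add: g_def fun_eq_iff)
  then have "\<sigma> p = 0" by (simp add: \<sigma>_def)
  ultimately show ?thesis by (rule that[rotated])
qed

text \<open>Smoothness of the inverse \<open>g\<close> is bootstrapped from the fact that its
  derivative is \<open>K (g y)\<close>: if \<open>g\<close> is \<open>n\<close> times
  differentiable, so is its derivative. Supplying \<open>K\<close> as a smooth family replaces the
  smoothness of matrix inversion; linearity of \<open>K p\<close> comes from its being a two-sided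
  inverse of a linear map.\<close>

lemma smooth_local_inverse:
  fixes \<phi> :: "'a::euclidean_space \<Rightarrow> 'a"
  assumes U: "open U" "p \<in> U" and \<phi>: "smooth_on U \<phi>"
    and K: "\<And>v. smooth_on U (\<lambda>x. K x v)"
    and KJ: "\<And>x v. x \<in> U \<Longrightarrow> K x (frechet_derivative \<phi> (at x) v) = v"
    and JK: "\<And>x v. x \<in> U \<Longrightarrow> frechet_derivative \<phi> (at x) (K x v) = v"
  obtains U' V where "open U'" "U' \<subseteq> U" "p \<in> U'" "open V" "bij_betw \<phi> U' V"
    "smooth_on V (inv_into U' \<phi>)"
proof -
  define J where "J x = Blinfun (frechet_derivative \<phi> (at x))" for x
  have J: "blinfun_apply (J x) = frechet_derivative \<phi> (at x)" if "x \<in> U" for x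
    unfolding J_def
    using smooth_on_has_derivative[OF \<phi> that] has_derivative_bounded_linear bounded_linear_Blinfun_apply
    by blast
  have "linear (K p)"
  proof -
    have "linear (frechet_derivative \<phi> (at p))"
      using smooth_on_has_derivative[OF \<phi> U(2)] has_derivative_linear by blast
    then obtain g where "linear g" "\<And>v. g (frechet_derivative \<phi> (at p) v) = v"
      using linear_injective_left_inverse KJ[OF U(2)]
      by (metis (mono_tags, lifting) comp_apply id_apply injI)
    then have "g v = K p v" for v using JK[OF U(2)] by metis
    then show ?thesis using \<open>linear g\<close> by (metis ext)
  qed
  then have Kp: "blinfun_apply (Blinfun (K p)) = K p"
    by (simp add: bounded_linear_Blinfun_apply linear_conv_bounded_linear)
  obtain U' V g g' where *: "open U'" "U' \<subseteq> U" "p \<in> U'" "open V" "\<phi> p \<in> V" "homeomorphism U' V \<phi> g"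
    "\<And>y. y \<in> V \<Longrightarrow> (g has_derivative (g' y)) (at y)"
    "\<And>y. y \<in> V \<Longrightarrow> g' y = inv (blinfun_apply (J (g y)))"
    "\<And>y. y \<in> V \<Longrightarrow> bij (blinfun_apply (J (g y)))"
  proof (rule inverse_function_theorem[OF U(1) _ _ U(2), of \<phi> J "Blinfun (K p)"])
    show "(\<phi> has_derivative blinfun_apply (J x)) (at x)" if "x \<in> U" for x
      using smooth_on_has_derivative[OF \<phi> that] J[OF that] by simp
    show "continuous_on U J"
    proof (rule continuous_on_blinfun_componentwise)
      fix i :: 'a
      show "continuous_on U (\<lambda>x. blinfun_apply (J x) i)"
        by (rule continuous_on_eq[OF smooth_on_continuous_on[OF smooth_on_frechet_derivative[OF \<phi>, of i]]])
          (simp add: J)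
    qed
    show "Blinfun (K p) o\<^sub>L J p = id_blinfun"
      by (rule blinfun_eqI) (simp add: Kp J KJ U(2))
  qed (rule that)
  note hom = *(6)
  have gU: "g y \<in> U'" "\<phi> (g y) = y" if "y \<in> V" for y
    using hom that unfolding homeomorphism_def by auto
  have bij: "bij_betw \<phi> U' V"
    using hom unfolding homeomorphism_def bij_betw_def by (metis inj_on_inverseI)
  have inv: "inv_into U' \<phi> y = g y" if "y \<in> V" for y
    using inv_into_f_f[OF bij_betw_imp_inj_on[OF bij] gU(1)[OF that]] gU(2)[OF that] by simp
  have g'K: "g' y = K (g y)" if "y \<in> V" for y
  proof
    fix v
    have gy: "g y \<in> U" using gU[OF that] *(2) by auto
    have "inv (frechet_derivative \<phi> (at (g y))) v = K (g y) v"
      using KJ[OF gy] JK[OF gy] by (metis inv_f_eq injI)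
    then show "g' y v = K (g y) v" using *(8)[OF that] J[OF gy] by simp
  qed
  have "times_differentiable_on n V g" for n
  proof (induction n)
    case 0
    then show ?case using hom by (simp add: homeomorphism_def)
  next
    case (Suc n)
    show ?case
    proof (rule times_differentiable_on_SucI[OF *(4)])
      show "(g has_derivative K (g y)) (at y)" if "y \<in> V" for y
        using *(7)[OF that] g'K[OF that] by simp
      show "times_differentiable_on n V (\<lambda>x. K (g x) v)" for v
        using K[of v] gU *(2) unfolding smooth_on_def
        by (intro times_differentiable_on_compose[OF *(4) _ Suc, of U]) auto
    qed
  qed
  then have "smooth_on V g" by (simp add: smooth_on_def)
  then have "smooth_on V (inv_into U' \<phi>)" using smooth_on_cong[OF *(4), of "inv_into U' \<phi>" g] inv by simp
  with *(1-4) bij show ?thesis by (intro that)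
qed

section \<open>Solutions of the oscillator equation\<close>

text \<open>Solutions of \<open>f'' = \<kappa> f\<close>, uniformly in the sign of \<open>\<kappa>\<close>, and a primitive of \<open>sink \<kappa>\<close>.\<close>

definition cosk :: "real \<Rightarrow> real \<Rightarrow> real" where
  "cosk \<kappa> y = (if \<kappa> > 0 then cosh (sqrt \<kappa> * y) else cos (sqrt (- \<kappa>) * y))"

definition sink :: "real \<Rightarrow> real \<Rightarrow> real" where
  "sink \<kappa> y = (if \<kappa> > 0 then sinh (sqrt \<kappa> * y) / sqrt \<kappa>
     else if \<kappa> < 0 then sin (sqrt (- \<kappa>) * y) / sqrt (- \<kappa>) else y)"

definition versk :: "real \<Rightarrow> real \<Rightarrow> real" where
  "versk \<kappa> y = (if \<kappa> = 0 then y\<^sup>2 / 2 else (cosk \<kappa> y - 1) / \<kappa>)"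

lemma DERIV_cosk: "(cosk \<kappa> has_real_derivative \<kappa> * sink \<kappa> y) (at y)"
  and DERIV_sink: "(sink \<kappa> has_real_derivative cosk \<kappa> y) (at y)"
proof -
  define r where "r = sqrt \<bar>\<kappa>\<bar>"
  have r: "r \<ge> 0" "\<bar>\<kappa>\<bar> = r * r" by (simp_all add: r_def)
  consider "\<kappa> > 0" | "\<kappa> < 0" | "\<kappa> = 0" by linarith
  then have "(cosk \<kappa> has_real_derivative \<kappa> * sink \<kappa> y) (at y) \<and>
    (sink \<kappa> has_real_derivative cosk \<kappa> y) (at y)"
  proof cases
    case 1
    then have k: "r > 0" "\<kappa> = r * r" using r(2) by (simp_all add: r_def)
    then have *: "cosk \<kappa> = (\<lambda>y. cosh (r * y))" "sink \<kappa> = (\<lambda>y. sinh (r * y) / r)"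
      by (auto simp: cosk_def sink_def fun_eq_iff)
    show ?thesis unfolding * unfolding k(2) using k(1) by (auto intro!: derivative_eq_intros)
  next
    case 2
    then have k: "r > 0" "\<kappa> = - (r * r)" using r(2) by (simp_all add: r_def)
    then have "\<not> 0 < - (r * r)" "- (r * r) < 0" by (simp_all add: not_less)
    with k have *: "cosk \<kappa> = (\<lambda>y. cos (r * y))" "sink \<kappa> = (\<lambda>y. sin (r * y) / r)"
      by (auto simp: cosk_def sink_def fun_eq_iff)
    show ?thesis unfolding * unfolding k(2) using k(1) by (auto intro!: derivative_eq_intros)
  next
    case 3
    then have "cosk \<kappa> = (\<lambda>y. 1)" "sink \<kappa> = (\<lambda>y. y)"
      by (auto simp: cosk_def sink_def)
    with 3 show ?thesis by auto
  qed
  then show "(cosk \<kappa> has_real_derivative \<kappa> * sink \<kappa> y) (at y)"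
    "(sink \<kappa> has_real_derivative cosk \<kappa> y) (at y)" by auto
qed

lemma DERIV_versk: "(versk \<kappa> has_real_derivative sink \<kappa> y) (at y)"
proof (cases "\<kappa> = 0")
  case True
  then show ?thesis
    by (auto intro!: derivative_eq_intros simp: versk_def[abs_def] sink_def)
next
  case False
  then show ?thesis unfolding versk_def[abs_def]
    by (auto intro!: derivative_eq_intros DERIV_cosk)
qed

lemmas has_derivative_cosk [derivative_intros] = DERIV_cosk[THEN DERIV_compose_FDERIV]
  and has_derivative_sink [derivative_intros] = DERIV_sink[THEN DERIV_compose_FDERIV]
  and has_derivative_versk [derivative_intros] = DERIV_versk[THEN DERIV_compose_FDERIV]
  and DERIV_cosk_chain [derivative_intros] = DERIV_cosk[THEN DERIV_chain2]
  and DERIV_sink_chain [derivative_intros] = DERIV_sink[THEN DERIV_chain2]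

lemma cosk_0 [simp]: "cosk \<kappa> 0 = 1" and sink_0 [simp]: "sink \<kappa> 0 = 0"
  and versk_0 [simp]: "versk \<kappa> 0 = 0"
  by (auto simp: cosk_def sink_def versk_def)

lemma cosk_eq: "cosk \<kappa> y = 1 + \<kappa> * versk \<kappa> y"
  by (auto simp: versk_def cosk_def)

text \<open>The difference of the two sides has derivative zero and vanishes at 0. Multiplied by
  \<kappa> it becomes the Pythagorean identity below, but unlike that one it still says something
  about \<open>sink\<close> when \<kappa> is 0.\<close>

lemma sink_squared: "(sink \<kappa> y)\<^sup>2 = versk \<kappa> y * (cosk \<kappa> y + 1)"
proof -
  have "\<exists>c. \<forall>y\<in>UNIV. (sink \<kappa> y)\<^sup>2 - versk \<kappa> y * (cosk \<kappa> y + 1) = c"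
    by (rule has_field_derivative_zero_constant)
      (auto intro!: derivative_eq_intros DERIV_cosk DERIV_sink DERIV_versk simp: cosk_eq algebra_simps)
  then obtain c where c: "(sink \<kappa> y)\<^sup>2 - versk \<kappa> y * (cosk \<kappa> y + 1) = c" for y by blast
  from c[of y] c[of 0] show ?thesis by simp
qed

lemma cosk_squared: "(cosk \<kappa> y)\<^sup>2 - \<kappa> * (sink \<kappa> y)\<^sup>2 = 1"
  unfolding sink_squared cosk_eq by algebra

lemma smooth_on_cosk_sink: "smooth_on UNIV (cosk \<kappa>)" "smooth_on UNIV (sink \<kappa>)"
proof -
  have "times_differentiable_on n UNIV (cosk \<kappa>) \<and> times_differentiable_on n UNIV (sink \<kappa>)" for n
  proof (induction n)
    case 0
    have "isCont (cosk \<kappa>) y" "isCont (sink \<kappa>) y" for y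
      using DERIV_cosk DERIV_sink DERIV_isCont by blast+
    then show ?case by (simp add: continuous_on_eq_continuous_at)
  next
    case (Suc n)
    note bl = times_differentiable_on_bounded_linear[where L = "\<lambda>z. c * z" for c, OF _ bounded_linear_mult_right]
    have "times_differentiable_on (Suc n) UNIV (cosk \<kappa>)"
      by (rule times_differentiable_on_SucI[where f' = "\<lambda>x v. v * (\<kappa> * sink \<kappa> x)"])
        (use Suc in \<open>auto intro!: has_derivative_eq_rhs[OF has_field_derivative_imp_has_derivative[OF DERIV_cosk]] bl\<close>)
    moreover have "times_differentiable_on (Suc n) UNIV (sink \<kappa>)"
      by (rule times_differentiable_on_SucI[where f' = "\<lambda>x v. v * cosk \<kappa> x"])
        (use Suc in \<open>auto intro!: has_derivative_eq_rhs[OF has_field_derivative_imp_has_derivative[OF DERIV_sink]] bl\<close>)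
    ultimately show ?case by blast
  qed
  then show "smooth_on UNIV (cosk \<kappa>)" "smooth_on UNIV (sink \<kappa>)" by (auto simp: smooth_on_def)
qed

lemma smooth_on_DERIV:
  fixes f :: "real \<Rightarrow> real"
  assumes "open U" "\<And>x. x \<in> U \<Longrightarrow> (f has_real_derivative f' x) (at x)" "smooth_on U f'"
  shows "smooth_on U f"
  by (rule smooth_onI[OF assms(1), where f' = "\<lambda>x v. f' x * v"])
    (use assms in \<open>auto simp: has_field_derivative_def intro: smooth_intros\<close>)

lemma smooth_on_versk: "smooth_on UNIV (versk \<kappa>)"
  by (rule smooth_on_DERIV[OF _ DERIV_versk smooth_on_cosk_sink(2)]) auto

lemma smooth_on_cosk_comp [smooth_intros]: "open U \<Longrightarrow> smooth_on U f \<Longrightarrow> smooth_on U (\<lambda>x. cosk \<kappa> (f x))"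
  and smooth_on_sink_comp [smooth_intros]: "open U \<Longrightarrow> smooth_on U f \<Longrightarrow> smooth_on U (\<lambda>x. sink \<kappa> (f x))"
  and smooth_on_versk_comp [smooth_intros]: "open U \<Longrightarrow> smooth_on U f \<Longrightarrow> smooth_on U (\<lambda>x. versk \<kappa> (f x))"
  using smooth_on_cosk_sink smooth_on_versk by (blast intro: smooth_on_compose)+

text \<open>In dimension one the closedness condition of the Poincare lemma holds for every
  function.\<close>

lemma smooth_primitive:
  fixes g :: "real \<Rightarrow> real"
  assumes "open I" "is_interval I" "smooth_on I g"
  obtains G where "\<And>x. x \<in> I \<Longrightarrow> (G has_real_derivative g x) (at x)" "smooth_on I G"
proof (cases "I = {}")
  case True
  then show ?thesis using that[of g] assms by auto
next
  case False
  then obtain p where "p \<in> I" by blast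
  have "frechet_derivative g (at x) u \<bullet> v = frechet_derivative g (at x) v \<bullet> u" if "x \<in> I" for x u v
  proof -
    have "linear (frechet_derivative g (at x))"
      using smooth_on_has_derivative[OF assms(3) that] has_derivative_linear by blast
    then have "frechet_derivative g (at x) w = w * frechet_derivative g (at x) 1" for w
      using linear_cmul[of _ w 1] by (metis mult.right_neutral real_scaleR_def)
    then show ?thesis by (metis inner_real_def mult.assoc mult.commute)
  qed
  from poincare_lemma_convex[OF assms(1) is_interval_convex[OF assms(2)] \<open>p \<in> I\<close> assms(3) this]
  obtain G where "\<And>x. x \<in> I \<Longrightarrow> (G has_derivative (\<lambda>v. g x \<bullet> v)) (at x)" by metis
  then have G: "(G has_real_derivative g x) (at x)" if "x \<in> I" for x
    using that by (simp add: has_field_derivative_def inner_real_def)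
  show ?thesis by (rule that[OF G smooth_on_DERIV[OF assms(1) G assms(3)]])
qed

section \<open>Killing fields\<close>

definition vec4 :: "real \<Rightarrow> real \<Rightarrow> real \<Rightarrow> real \<Rightarrow> real^4" where
  "vec4 a b c d = a *\<^sub>R axis 1 1 + b *\<^sub>R axis 2 1 + c *\<^sub>R axis 3 1 + d *\<^sub>R axis 4 1"

lemma vec4_nth [simp]: "vec4 a b c d $ 1 = a" "vec4 a b c d $ 2 = b" "vec4 a b c d $ 3 = c"
  "vec4 a b c d $ 4 = d"
  by (auto simp: vec4_def axis_def)

lemma vec4_eq_iff: "(u::real^4) = v \<longleftrightarrow> u $ 1 = v $ 1 \<and> u $ 2 = v $ 2 \<and> u $ 3 = v $ 3 \<and> u $ 4 = v $ 4"
  unfolding vec_eq_iff forall_4 ..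

lemma smooth_on_vec4 [smooth_intros]:
  "open U \<Longrightarrow> smooth_on U a \<Longrightarrow> smooth_on U b \<Longrightarrow> smooth_on U c \<Longrightarrow> smooth_on U d
    \<Longrightarrow> smooth_on U (\<lambda>x. vec4 (a x) (b x) (c x) (d x))"
  unfolding vec4_def by (intro smooth_intros)

lemma has_derivative_vec4 [derivative_intros]:
  "(a has_derivative a') F \<Longrightarrow> (b has_derivative b') F \<Longrightarrow> (c has_derivative c') F \<Longrightarrow> (d has_derivative d') F
    \<Longrightarrow> ((\<lambda>x. vec4 (a x) (b x) (c x) (d x)) has_derivative (\<lambda>h. vec4 (a' h) (b' h) (c' h) (d' h))) F"
  unfolding vec4_def by (intro derivative_intros)

lemma has_derivative_vec_nth [derivative_intros]:
  "(f has_derivative f') F \<Longrightarrow> ((\<lambda>x. f x $ i) has_derivative (\<lambda>h. f' h $ i)) F"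
  by (rule bounded_linear.has_derivative[OF bounded_linear_vec_nth])


lemma DERIV_vec_nth:
  assumes "(f has_real_derivative f') (at (p $ i))"
  shows "((\<lambda>q. f (q $ i)) has_derivative (\<lambda>u. f' * u $ i)) (at p)"
  using DERIV_compose_FDERIV[OF assms has_derivative_vec_nth[OF has_derivative_ident]]
  by (simp add: mult.commute)

lemma goedel_rc_simps [simp]:
  "points (goedel_rc I J H D S) = {p. p $ 2 \<in> I \<and> p $ 4 \<in> J}"
  "metric (goedel_rc I J H D S) p u v =
     (u $ 1 + H (p $ 2) * u $ 3) * (v $ 1 + H (p $ 2) * v $ 3)
         - (D (p $ 2))\<^sup>2 * (u $ 3 * v $ 3) - u $ 2 * v $ 2 - u $ 4 * v $ 4"
  "torsion (goedel_rc I J H D S) p u v =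
     vec4 (D (p $ 2) * S (p $ 4) * (u $ 2 * v $ 3 - u $ 3 * v $ 2)) 0 0 0"
  by (simp_all add: goedel_rc_def vec4_def)

lemma open_points: 
  assumes "open I" "open J"
  shows "open {p::real^4. p $ 2 \<in> I \<and> p $ 4 \<in> J}"
proof -
  have "{p::real^4. p $ 2 \<in> I \<and> p $ 4 \<in> J} = (\<lambda>p. p $ 2) -` I \<inter> (\<lambda>p. p $ 4) -` J" by auto
  then show ?thesis
    using assms by (auto intro!: open_Int open_vimage continuous_intros)
qed

text \<open>With \<open>X = \<xi>\<^sup>t \<partial>\<^sub>t + \<xi>\<^sup>x \<partial>\<^sub>x + \<xi>\<^sup>y \<partial>\<^sub>y + c \<partial>\<^sub>z\<close>, the four numerical equations are the Killing equations.\<close>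

lemma infinitesimal_motion_goedelI:
  assumes I: "open I" "open J"
    and H: "\<And>x. x \<in> I \<Longrightarrow> (H has_real_derivative H' x) (at x)"
    and D: "\<And>x. x \<in> I \<Longrightarrow> (D has_real_derivative D' x) (at x)"
    and S: "\<And>z. z \<in> J \<Longrightarrow> S z = S0"
    and X: "smooth_on {p. p $ 2 \<in> I \<and> p $ 4 \<in> J} X"
    and dX: "\<And>p. p $ 2 \<in> I \<Longrightarrow> p $ 4 \<in> J \<Longrightarrow> (X has_derivative (\<lambda>u. vec4 (Tx p * u $ 2 + Ty p * u $ 3)
       (Ay p * u $ 3) (Bx p * u $ 2 + By p * u $ 3) 0)) (at p)"
    and eqs: "\<And>p. p $ 2 \<in> I \<Longrightarrow> p $ 4 \<in> J \<Longrightarrow> Tx p = - H (p $ 2) * Bx p \<and>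
       Ty p = - H' (p $ 2) * X p $ 2 - H (p $ 2) * By p \<and> Ay p = - (D (p $ 2))\<^sup>2 * Bx p \<and>
       D (p $ 2) * By p = - D' (p $ 2) * X p $ 2"
  shows "infinitesimal_motion (goedel_rc I J H D S) X"
  unfolding infinitesimal_motion_def Let_def
proof (intro conjI ballI allI)
  let ?M = "goedel_rc I J H D S"
  show "smooth_on (points ?M) X" using X by simp
  fix p u v assume "p \<in> points ?M"
  then have p: "p $ 2 \<in> I" "p $ 4 \<in> J" by auto
  have fX: "frechet_derivative X (at p) = (\<lambda>u. vec4 (Tx p * u $ 2 + Ty p * u $ 3)
       (Ay p * u $ 3) (Bx p * u $ 2 + By p * u $ 3) 0)"
    by (rule frechet_derivative_at[OF dX[OF p], symmetric])
  note Hp = DERIV_vec_nth[OF H[OF p(1)]] and Dp = DERIV_vec_nth[OF D[OF p(1)]]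
  have e: "Tx p = - H (p $ 2) * Bx p" "Ty p = - H' (p $ 2) * X p $ 2 - H (p $ 2) * By p"
    "Ay p = - (D (p $ 2))\<^sup>2 * Bx p" and e4: "D (p $ 2) * By p = - D' (p $ 2) * X p $ 2"
    using eqs[OF p] by auto
  have "((\<lambda>q. metric ?M q u v) has_derivative (\<lambda>w. H' (p $ 2) * w $ 2 * (u $ 3 * (v $ 1 + H (p $ 2) * v $ 3)
      + (u $ 1 + H (p $ 2) * u $ 3) * v $ 3) - 2 * D (p $ 2) * D' (p $ 2) * w $ 2 * (u $ 3 * v $ 3))) (at p)"
    by (auto intro!: derivative_eq_intros Hp Dp simp: algebra_simps fun_eq_iff)
  note fm = frechet_derivative_at[OF this, symmetric]
  show "frechet_derivative (\<lambda>q. metric ?M q u v) (at p) (X p)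
    + metric ?M p (frechet_derivative X (at p) u) v + metric ?M p u (frechet_derivative X (at p) v) = 0"
    unfolding fm fX using e4 by (simp add: e del: power2_eq_square) algebra
  \<comment> \<open>No coefficient of \<open>X\<close> depends on t, so \<open>X\<close> commutes
    with the field along t. What remains of the torsion equation is that the area form D dx dy is
    preserved, which is the fourth of \<open>eqs\<close>.\<close>
  have "((\<lambda>q. vec4 (D (q $ 2) * S0 * (u $ 2 * v $ 3 - u $ 3 * v $ 2)) 0 0 0) has_derivative
      (\<lambda>w. vec4 (D' (p $ 2) * w $ 2 * S0 * (u $ 2 * v $ 3 - u $ 3 * v $ 2)) 0 0 0)) (at p)"
    by (auto intro!: derivative_eq_intros Dp simp: algebra_simps fun_eq_iff)
  then have "((\<lambda>q. torsion ?M q u v) has_derivative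
      (\<lambda>w. vec4 (D' (p $ 2) * w $ 2 * S0 * (u $ 2 * v $ 3 - u $ 3 * v $ 2)) 0 0 0)) (at p)"
    by (rule has_derivative_transform_within_open[OF _ open_points[OF I]]) (use p S in auto)
  note fm = frechet_derivative_at[OF this, symmetric]
  show "frechet_derivative (\<lambda>q. torsion ?M q u v) (at p) (X p)
    + torsion ?M p (frechet_derivative X (at p) u) v + torsion ?M p u (frechet_derivative X (at p) v)
    - frechet_derivative X (at p) (torsion ?M p u v) = 0"
    unfolding fm fX using e4 by (simp add: vec4_eq_iff S[OF p(2)]) algebra
qed

section \<open>The five-dimensional algebra of Killing fields\<close>

locale goedel_constant =
  fixes I J :: "real set" and H D S D' :: "real \<Rightarrow> real" and m2 \<Omega> S0 :: real
  assumes I: "open I" "is_interval I" "I \<noteq> {}" and J: "open J" "J \<noteq> {}"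
    and smooth: "smooth_on I H" "smooth_on I D" "smooth_on I D'"
    and D_nz: "x \<in> I \<Longrightarrow> D x \<noteq> 0"
    and DERIV_D: "x \<in> I \<Longrightarrow> (D has_real_derivative D' x) (at x)"
    and DERIV_D': "x \<in> I \<Longrightarrow> (D' has_real_derivative m2 * D x) (at x)"
    and DERIV_H: "x \<in> I \<Longrightarrow> (H has_real_derivative \<Omega> * D x) (at x)"
    and S_eq: "z \<in> J \<Longrightarrow> S z = S0"
begin

lemma constant_on_I:
  assumes "\<And>x. x \<in> I \<Longrightarrow> (f has_real_derivative 0) (at x)"
  obtains c where "\<And>x. x \<in> I \<Longrightarrow> f x = c"
  using has_field_derivative_zero_constant[OF is_interval_convex[OF I(2)], of f] assms
    has_field_derivative_at_within by blast

abbreviation "M \<equiv> goedel_rc I J H D S"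
abbreviation "pts \<equiv> {p::real^4. p $ 2 \<in> I \<and> p $ 4 \<in> J}"

lemma open_pts: "open pts"
  by (rule open_points[OF I(1) J(1)])

lemma smooth_on_nth2:
  "smooth_on I f \<Longrightarrow> smooth_on pts (\<lambda>p. f (p $ 2))"
  by (rule smooth_on_compose[OF open_pts], assumption, intro smooth_intros open_pts) auto

text \<open>
  With \<open>f'' = \<kappa> f\<close>, the Killing fields of the surface \<open>dx\<^sup>2 + D\<^sup>2 dy\<^sup>2\<close> are
  \<open>f(y) \<partial>\<^sub>x + (f'(y) k(x) - \<beta> \<integral>f) \<partial>\<^sub>y\<close>, where \<open>k' = - 1 / D\<^sup>2\<close> and \<open>D' / D + \<kappa> k = \<beta>\<close>;
  the component along \<open>\<partial>\<^sub>t\<close> lifts them to the four-dimensional space.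
\<close>

lemma admits_motion_group_5: "admits_motion_group M 5"
proof -
  \<comment> \<open>A first integral of \<open>D'' = m2 D\<close>. Divided by
    \<open>D\<^sup>2\<close> it is the derivative of \<open>D' / D\<close>, and this makes \<kappa>
    the coefficient of the oscillator equation in y.\<close>
  obtain \<kappa> where \<kappa>: "m2 * (D x)\<^sup>2 - (D' x)\<^sup>2 = \<kappa>" if "x \<in> I" for x
    by (rule constant_on_I[of "\<lambda>x. m2 * (D x)\<^sup>2 - (D' x)\<^sup>2"])
      (auto intro!: derivative_eq_intros DERIV_D DERIV_D')
  have sm: "smooth_on I (\<lambda>x. - 1 / (D x)\<^sup>2)" "smooth_on I (\<lambda>x. H x / (D x)\<^sup>2)"
    "smooth_on I (\<lambda>x. D' x / D x)"
    using D_nz by (auto intro!: smooth_intros I smooth)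
  obtain k where k: "\<And>x. x \<in> I \<Longrightarrow> (k has_real_derivative - 1 / (D x)\<^sup>2) (at x)" "smooth_on I k"
    using smooth_primitive[OF I(1,2) sm(1)] by blast
  obtain W where W: "\<And>x. x \<in> I \<Longrightarrow> (W has_real_derivative H x / (D x)\<^sup>2) (at x)" "smooth_on I W"
    using smooth_primitive[OF I(1,2) sm(2)] by blast
  define q where "q x = D' x / D x" for x
  \<comment> \<open>The equation for \<open>Ty\<close> forces this factor in the component along t.
    Its derivative is \<kappa> times that of \<open>W\<close>, so the pair \<open>P\<close>,
    \<open>W\<close> behaves like the pair \<open>q\<close>, \<open>- k\<close>.\<close>
  define P where "P x = H x * q x - \<Omega> * D x" for x
  have q: "(q has_real_derivative \<kappa> / (D x)\<^sup>2) (at x)" if x: "x \<in> I" for x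
    unfolding q_def[abs_def]
    by (rule derivative_eq_intros DERIV_D DERIV_D' x D_nz refl)+
      (use D_nz[OF x] \<kappa>[OF x] in \<open>simp add: power2_eq_square divide_simps algebra_simps\<close>)
  have qD: "q x * D x = D' x" if "x \<in> I" for x using D_nz[OF that] by (simp add: q_def)
  have P: "(P has_real_derivative \<kappa> * H x / (D x)\<^sup>2) (at x)" if x: "x \<in> I" for x
    unfolding P_def[abs_def]
    by (rule derivative_eq_intros DERIV_D DERIV_H q x refl)+ (use qD[OF x] in \<open>simp add: algebra_simps\<close>)
  have smq: "smooth_on I q" "smooth_on I P"
    unfolding q_def[abs_def] P_def[abs_def]
    by (intro smooth_intros I smooth, simp add: D_nz)+
  obtain \<beta> where \<beta>: "q x + \<kappa> * k x = \<beta>" if "x \<in> I" for x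
    by (rule constant_on_I[of "\<lambda>x. q x + \<kappa> * k x"]) (auto intro!: derivative_eq_intros q k)
  obtain a where a: "P x - \<kappa> * W x = a" if "x \<in> I" for x
    by (rule constant_on_I[of "\<lambda>x. P x - \<kappa> * W x"]) (auto intro!: derivative_eq_intros P W)
  have rel: "\<kappa> / (D x)\<^sup>2 = m2 - (q x)\<^sup>2" if "x \<in> I" for x
    using \<kappa>[OF that] D_nz[OF that] by (simp add: q_def power2_eq_square field_simps)
  define r where "r x = 1 / D x" for x
  have r: "(r has_real_derivative - q x * r x) (at x)" if x: "x \<in> I" for x
    unfolding r_def[abs_def]
    by (rule derivative_eq_intros DERIV_D x D_nz refl)+
      (use D_nz[OF x] in \<open>simp add: q_def power2_eq_square field_simps\<close>)
  have r2: "1 / (D x)\<^sup>2 = (r x)\<^sup>2" for x by (simp add: r_def power_divide)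
  have rD: "r x * D x = 1" if "x \<in> I" for x using D_nz[OF that] by (simp add: r_def)
  \<comment> \<open>Structure constants: \<open>a2\<close> and \<open>c2\<close> are the
    coefficients of \<open>X0\<close> and \<open>X2\<close> in the bracket of \<open>X3\<close> with
    \<open>X4\<close>, as \<open>a\<close> and \<open>- \<beta>\<close> are in the bracket of
    \<open>X2\<close> with \<open>X3\<close>.\<close>
  obtain c2 where c2: "- (r x)\<^sup>2 + 2 * \<beta> * k x - \<kappa> * (k x)\<^sup>2 = c2" if "x \<in> I" for x
  proof (rule constant_on_I[of "\<lambda>x. - (r x)\<^sup>2 + 2 * \<beta> * k x - \<kappa> * (k x)\<^sup>2"])
    fix x assume x: "x \<in> I"
    show "((\<lambda>x. - (r x)\<^sup>2 + 2 * \<beta> * k x - \<kappa> * (k x)\<^sup>2) has_real_derivative 0) (at x)"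
      apply (rule derivative_eq_intros r k x refl)+
      apply (simp add: minus_divide_left[symmetric] r2 \<beta>[OF x, symmetric])
      by (simp add: algebra_simps power2_eq_square)
  qed (rule that)
  obtain a2 where a2: "H x * (r x)\<^sup>2 - k x * P x + \<beta> * W x = a2" if "x \<in> I" for x
  proof (rule constant_on_I[of "\<lambda>x. H x * (r x)\<^sup>2 - k x * P x + \<beta> * W x"])
    fix x assume x: "x \<in> I"
    have "H x / (D x)\<^sup>2 = H x * (r x)\<^sup>2" "\<kappa> * H x / (D x)\<^sup>2 = \<kappa> * H x * (r x)\<^sup>2" "- 1 / (D x)\<^sup>2 = - (r x)\<^sup>2"
      by (simp_all add: r_def power_divide)
    note d = W(1)[OF x, unfolded this] k(1)[OF x, unfolded this] P[OF x, unfolded this]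
    show "((\<lambda>x. H x * (r x)\<^sup>2 - k x * P x + \<beta> * W x) has_real_derivative 0) (at x)"
      apply (rule derivative_eq_intros r DERIV_H d x refl)+
      using rD[OF x] \<beta>[OF x] unfolding P_def by simp algebra
  qed (rule that)
  define X0 :: "real^4 \<Rightarrow> real^4" where "X0 p = vec4 1 0 0 0" for p
  define X1 :: "real^4 \<Rightarrow> real^4" where "X1 p = vec4 0 0 0 1" for p
  define X2 :: "real^4 \<Rightarrow> real^4" where "X2 p = vec4 0 0 1 0" for p
  \<comment> \<open>\<open>X3\<close> and \<open>X4\<close> take \<open>cosk \<kappa>\<close> and
    \<open>sink \<kappa>\<close> for f, with primitives \<open>sink \<kappa>\<close> and
    \<open>versk \<kappa>\<close>; their components along y are simplified by means of
    \<open>\<kappa> * k x - \<beta> = - q x\<close>.\<close>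
  define X3 :: "real^4 \<Rightarrow> real^4" where
    "X3 p = vec4 (sink \<kappa> (p $ 3) * P (p $ 2)) (cosk \<kappa> (p $ 3)) (- (sink \<kappa> (p $ 3) * q (p $ 2))) 0" for p
  define X4 :: "real^4 \<Rightarrow> real^4" where
    "X4 p = vec4 (W (p $ 2) + versk \<kappa> (p $ 3) * P (p $ 2)) (sink \<kappa> (p $ 3))
      (k (p $ 2) - versk \<kappa> (p $ 3) * q (p $ 2)) 0" for p
  note dn = DERIV_vec_nth
  note trig = DERIV_cosk DERIV_sink DERIV_versk
  have dc: "(X0 has_derivative (\<lambda>u. vec4 0 0 0 0)) (at p)" "(X1 has_derivative (\<lambda>u. vec4 0 0 0 0)) (at p)"
    "(X2 has_derivative (\<lambda>u. vec4 0 0 0 0)) (at p)" for p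
    by (auto simp: X0_def[abs_def] X1_def[abs_def] X2_def[abs_def] vec4_def)
  have d3: "(X3 has_derivative (\<lambda>u. vec4 (sink \<kappa> (p $ 3) * \<kappa> * H (p $ 2) / (D (p $ 2))\<^sup>2 * u $ 2 +
        cosk \<kappa> (p $ 3) * P (p $ 2) * u $ 3) (\<kappa> * sink \<kappa> (p $ 3) * u $ 3)
        (- (sink \<kappa> (p $ 3) * \<kappa> / (D (p $ 2))\<^sup>2) * u $ 2 + (- cosk \<kappa> (p $ 3) * q (p $ 2)) * u $ 3) 0)) (at p)"
    if "p $ 2 \<in> I" for p
    unfolding X3_def
    by (rule derivative_eq_intros dn[OF trig(1)] dn[OF trig(2)] dn[OF P] dn[OF q] that refl)+
      (auto simp: fun_eq_iff vec4_eq_iff algebra_simps)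
  have d4: "(X4 has_derivative (\<lambda>u. vec4 (cosk \<kappa> (p $ 3) * H (p $ 2) / (D (p $ 2))\<^sup>2 * u $ 2 +
        sink \<kappa> (p $ 3) * P (p $ 2) * u $ 3) (cosk \<kappa> (p $ 3) * u $ 3)
        (- (cosk \<kappa> (p $ 3) / (D (p $ 2))\<^sup>2) * u $ 2 + (- sink \<kappa> (p $ 3) * q (p $ 2)) * u $ 3) 0)) (at p)"
    if "p $ 2 \<in> I" for p
    unfolding X4_def cosk_eq
    by (rule derivative_eq_intros dn[OF trig(2)] dn[OF trig(3)] dn[OF P] dn[OF q] dn[OF W(1)] dn[OF k(1)] that refl)+
      (auto simp: fun_eq_iff vec4_eq_iff cosk_eq algebra_simps add_divide_distrib)
  have sX: "smooth_on pts X0" "smooth_on pts X1" "smooth_on pts X2" "smooth_on pts X3" "smooth_on pts X4"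
    unfolding X0_def[abs_def] X1_def[abs_def] X2_def[abs_def] X3_def[abs_def] X4_def[abs_def]
    by (intro smooth_intros smooth_on_nth2 smq k W open_pts)+
  note mot = infinitesimal_motion_goedelI[OF I(1) J(1) DERIV_H DERIV_D S_eq]
  have m0: "infinitesimal_motion M X0"
    by (rule mot[where Tx = "\<lambda>_. 0" and Ty = "\<lambda>_. 0" and Ay = "\<lambda>_. 0" and Bx = "\<lambda>_. 0" and By = "\<lambda>_. 0"])
      (use sX dc in \<open>auto simp: X0_def\<close>)
  have m1: "infinitesimal_motion M X1"
    by (rule mot[where Tx = "\<lambda>_. 0" and Ty = "\<lambda>_. 0" and Ay = "\<lambda>_. 0" and Bx = "\<lambda>_. 0" and By = "\<lambda>_. 0"])
      (use sX dc in \<open>auto simp: X1_def\<close>)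
  have m2: "infinitesimal_motion M X2"
    by (rule mot[where Tx = "\<lambda>_. 0" and Ty = "\<lambda>_. 0" and Ay = "\<lambda>_. 0" and Bx = "\<lambda>_. 0" and By = "\<lambda>_. 0"])
      (use sX dc in \<open>auto simp: X2_def\<close>)
  have m3: "infinitesimal_motion M X3"
    by (rule infinitesimal_motion_goedelI[OF I(1) J(1) DERIV_H DERIV_D S_eq sX(4) d3])
      (use D_nz qD in \<open>auto simp: X3_def P_def algebra_simps\<close>)
  have m4: "infinitesimal_motion M X4"
    by (rule infinitesimal_motion_goedelI[OF I(1) J(1) DERIV_H DERIV_D S_eq sX(5) d4])
      (use D_nz qD in \<open>auto simp: X4_def P_def algebra_simps\<close>)
  define X where "X i = [X0, X1, X2, X3, X4] ! i" for i :: nat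
  have X_simps: "X 0 = X0" "X (Suc 0) = X1" "X (Suc (Suc 0)) = X2" "X (Suc (Suc (Suc 0))) = X3"
    "X (Suc (Suc (Suc (Suc 0)))) = X4" by (auto simp: X_def)
  have sum5: "(\<Sum>i<5. f i) = f 0 + f (Suc 0) + f (Suc (Suc 0)) + f (Suc (Suc (Suc 0))) + f (Suc (Suc (Suc (Suc 0))))"
    for f :: "nat \<Rightarrow> 'a::comm_monoid_add" by (simp add: eval_nat_numeral)
  have less5: "i < 5 \<longleftrightarrow> i = 0 \<or> i = Suc 0 \<or> i = Suc (Suc 0) \<or> i = Suc (Suc (Suc 0)) \<or> i = Suc (Suc (Suc (Suc 0)))"
    for i :: nat by auto
  have "\<forall>i<5. infinitesimal_motion M (X i)"
    unfolding less5 using m0 m1 m2 m3 m4 by (auto simp: X_simps)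
  moreover have "\<forall>i<5. c i = 0" if "\<forall>p\<in>points M. (\<Sum>i<5. c i *\<^sub>R X i p) = 0" for c
  proof -
    obtain x z where xz: "x \<in> I" "z \<in> J" using I J by blast
    have eq: "c 0 *\<^sub>R X0 p + c (Suc 0) *\<^sub>R X1 p + c (Suc (Suc 0)) *\<^sub>R X2 p + c (Suc (Suc (Suc 0))) *\<^sub>R X3 p
        + c (Suc (Suc (Suc (Suc 0)))) *\<^sub>R X4 p = 0" if "p $ 2 = x" "p $ 4 = z" for p
      using \<open>\<forall>p\<in>points M. _\<close> xz that unfolding sum5 X_simps by simp
    \<comment> \<open>Where y = 0, only \<open>X3\<close> has a component along x. A point with
      \<open>sink \<kappa> y \<noteq> 0\<close> then isolates \<open>X4\<close>, and the other three
      fields are constant.\<close>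
    have c3: "c (Suc (Suc (Suc 0))) = 0" 
      using eq[of "vec4 0 x 0 z"] by (simp add: vec4_eq_iff X0_def X1_def X2_def X3_def X4_def)
    have "\<exists>y. sink \<kappa> y \<noteq> 0"
    proof (rule ccontr)
      assume "\<not> ?thesis"
      then have "sink \<kappa> = (\<lambda>y. 0)" by auto
      then show False using DERIV_unique[OF DERIV_sink[of \<kappa> 0], of 0] by simp
    qed
    then obtain y where "sink \<kappa> y \<noteq> 0" ..
    then have "c (Suc (Suc (Suc (Suc 0)))) = 0"
      using eq[of "vec4 0 x y z"] c3 by (simp add: vec4_eq_iff X0_def X1_def X2_def X3_def X4_def)
    then show ?thesis unfolding less5
      using eq[of "vec4 0 x 0 z"] c3 by (auto simp: vec4_eq_iff X0_def X1_def X2_def)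
  qed
  moreover have "\<forall>i<5. \<forall>j<5. \<exists>c. \<forall>p\<in>points M. lie_bracket (X i) (X j) p = (\<Sum>k<5. c k *\<^sub>R X k p)"
  proof -
    define B where "B Y Z \<longleftrightarrow> (\<exists>c. \<forall>p\<in>points M. lie_bracket Y Z p = (\<Sum>k<5. c k *\<^sub>R X k p))" for Y Z
    have BI: "B Y Z" if "\<And>p. p $ 2 \<in> I \<Longrightarrow> p $ 4 \<in> J \<Longrightarrow> lie_bracket Y Z p = b0 *\<^sub>R X0 p + b2 *\<^sub>R X2 p + b3 *\<^sub>R X3 p + b4 *\<^sub>R X4 p"
      for Y Z b0 b2 b3 b4
      unfolding B_def using that
      by (intro exI[of _ "(!) [b0, 0, b2, b3, b4]"]) (auto simp: sum5 X_simps)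
    have B_sym: "B Z Y" if "B Y Z" for Y Z
    proof -
      have "lie_bracket Z Y p = - lie_bracket Y Z p" for p by (simp add: lie_bracket_def)
      obtain c where "\<forall>p\<in>points M. lie_bracket Y Z p = (\<Sum>k<5. c k *\<^sub>R X k p)" using \<open>B Y Z\<close> B_def by blast
      then have "\<forall>p\<in>points M. lie_bracket Z Y p = (\<Sum>k<5. (- c k) *\<^sub>R X k p)"
        using \<open>\<And>p. lie_bracket Z Y p = - lie_bracket Y Z p\<close> by (simp add: sum_negf)
      then show ?thesis unfolding B_def by (rule exI[of _ "\<lambda>k. - c k"])
    qed
    have B_self: "B Y Y" for Y
      by (rule BI[of _ _ 0 0 0 0]) (simp add: lie_bracket_def)
    have fr: "frechet_derivative X0 (at p) = (\<lambda>u. vec4 0 0 0 0)" "frechet_derivative X1 (at p) = (\<lambda>u. vec4 0 0 0 0)"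
        "frechet_derivative X2 (at p) = (\<lambda>u. vec4 0 0 0 0)" for p
      using dc frechet_derivative_at by metis+
    note fr3 = frechet_derivative_at[OF d3, symmetric] and fr4 = frechet_derivative_at[OF d4, symmetric]
    note Xs = X0_def X1_def X2_def X3_def X4_def
    have b0: "B X0 X1" "B X0 X2" "B X0 X3" "B X0 X4" "B X1 X2" "B X1 X3" "B X1 X4"
      by (rule BI[of _ _ 0 0 0 0]; simp add: lie_bracket_def fr fr3 fr4 vec4_eq_iff Xs)+
    have b23: "B X2 X3"
    proof (rule BI[of _ _ a "- \<beta>" 0 \<kappa>])
      fix p :: "real^4" assume p: "p $ 2 \<in> I" "p $ 4 \<in> J"
      show "lie_bracket X2 X3 p = a *\<^sub>R X0 p + (- \<beta>) *\<^sub>R X2 p + 0 *\<^sub>R X3 p + \<kappa> *\<^sub>R X4 p"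
        by (simp add: lie_bracket_def fr fr3[OF p(1)] vec4_eq_iff Xs cosk_eq
            a[OF p(1), symmetric] \<beta>[OF p(1), symmetric] algebra_simps)
    qed
    have b24: "B X2 X4"
      by (rule BI[of _ _ 0 0 1 0]) (simp add: lie_bracket_def fr fr4 vec4_eq_iff Xs)
    have b34: "B X3 X4"
    proof (rule BI[of _ _ a2 c2 0 "- \<beta>"])
      fix p :: "real^4" assume p: "p $ 2 \<in> I" "p $ 4 \<in> J"
      have x: "p $ 2 \<in> I" using p by simp
      have rr: "b / (D (p $ 2))\<^sup>2 = b * (r (p $ 2))\<^sup>2" for b by (simp add: r_def power_divide)
      show "lie_bracket X3 X4 p = a2 *\<^sub>R X0 p + c2 *\<^sub>R X2 p + 0 *\<^sub>R X3 p + (- \<beta>) *\<^sub>R X4 p"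
        apply (simp add: lie_bracket_def fr3[OF p(1)] fr4[OF p(1)] vec4_eq_iff Xs rr
            a2[OF x, symmetric] c2[OF x, symmetric] \<beta>[OF x, symmetric])
        using cosk_eq[of \<kappa> "p $ 3"] sink_squared[of \<kappa> "p $ 3"]
        apply (intro conjI)
        subgoal by algebra
        subgoal by algebra
        subgoal by algebra
        done
    qed
    have "B (X i) (X j)" if "i < 5" "j < 5" for i j
      using that b0 b23 b24 b34 B_self B_sym unfolding less5 by (auto simp: X_simps)
    then show ?thesis unfolding B_def by blast
  qed
  ultimately show ?thesis
    unfolding admits_motion_group_def by blast
qed

end

section \<open>Local isometries to a neutral model\<close>

text \<open>The surface is realised on the quadric w^2 = 1 + m2 (A^2 + B^2), with A, B, w as ambient
  coordinates. Here \<open>c\<close>, \<open>h\<close> stand for the oscillator functions in x,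
  \<open>C\<close>, \<open>s\<close> for those in y, and \<open>V\<close> for \<open>versk\<close>.
  The pair \<open>ex\<close>, \<open>ey\<close> is the differential of w divided by
  \<open>m2\<close>, in a closed form that makes sense for \<open>m2 = 0\<close>. The three
  identities with quadratic terms in it say that dA^2 + dB^2 - dw^2 / m2 is the metric dx^2 + D^2
  dy^2. Then come the area form, the components of A dB - B dA and, cleared of the denominator (1 +
  w)^2, the exterior derivative of (A dB - B dA) / (1 + w).\<close>

lemma surface_identities:
  fixes c h s V m2 D0 D1 :: real
  defines "\<kappa> \<equiv> m2 * D0\<^sup>2 - D1\<^sup>2" and "D \<equiv> D0 * c + D1 * h" and "D' \<equiv> m2 * D0 * h + D1 * c"
  defines "C \<equiv> 1 + \<kappa> * V"
  defines "A \<equiv> h - D1 * D * V" and "Ax \<equiv> c - D1 * D' * V" and "Ay \<equiv> - (D1 * D * s)"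
    and "B \<equiv> D * s" and "Bx \<equiv> D' * s" and "By \<equiv> D * C" and "w \<equiv> c + m2 * D0 * D * V"
    and "ex \<equiv> h + D0 * D' * V" and "ey \<equiv> D0 * D * s"
  assumes c: "c\<^sup>2 = 1 + m2 * h\<^sup>2" and s: "s\<^sup>2 = V * (C + 1)"
  shows "w\<^sup>2 = 1 + m2 * (A\<^sup>2 + B\<^sup>2)"
    and "A * Ax + B * Bx = w * ex" "A * Ay + B * By = w * ey"
    and "Ax\<^sup>2 + Bx\<^sup>2 - m2 * ex\<^sup>2 = 1" "Ax * Ay + Bx * By - m2 * ex * ey = 0"
    "Ay\<^sup>2 + By\<^sup>2 - m2 * ey\<^sup>2 = D\<^sup>2" and "Ax * By - Ay * Bx = w * D"
    and "A * Bx - B * Ax = - (D0 * s)" "A * By - B * Ay = D * (h * C + D1 * D * V)"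
    and "D0 * (C * (1 + w) - s * (m2 * D0 * D * s)) =
      D * (1 + w)\<^sup>2 - ((D' * (h * C + D1 * D * V) + D * (c * C + D1 * D' * V)) * (1 + w)
        - D * (h * C + D1 * D * V) * (m2 * ex))"
proof -
  note defs = A_def Ax_def Ay_def B_def Bx_def By_def w_def ex_def ey_def D_def D'_def C_def \<kappa>_def
  note s' = s[unfolded C_def \<kappa>_def]
  show "w\<^sup>2 = 1 + m2 * (A\<^sup>2 + B\<^sup>2)" unfolding defs using c s' by algebra
  show "A * Ax + B * Bx = w * ex" unfolding defs using c s' by algebra
  show "A * Ay + B * By = w * ey" unfolding defs by algebra
  show "Ax\<^sup>2 + Bx\<^sup>2 - m2 * ex\<^sup>2 = 1" unfolding defs using c s' by algebra
  show "Ax * Ay + Bx * By - m2 * ex * ey = 0" unfolding defs by algebra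
  show "Ay\<^sup>2 + By\<^sup>2 - m2 * ey\<^sup>2 = D\<^sup>2" unfolding defs using c s' by algebra
  show "Ax * By - Ay * Bx = w * D" unfolding defs using c s' by algebra
  show "A * Bx - B * Ax = - (D0 * s)" unfolding defs using c s' by algebra
  show "A * By - B * Ay = D * (h * C + D1 * D * V)" unfolding defs using c s' by algebra
  show "D0 * (C * (1 + w) - s * (m2 * D0 * D * s)) =
      D * (1 + w)\<^sup>2 - ((D' * (h * C + D1 * D * V) + D * (c * C + D1 * D' * V)) * (1 + w)
        - D * (h * C + D1 * D * V) * (m2 * ex))" unfolding defs using c s' by algebra
qed

section \<open>Derivatives, composition and construction of local isometries\<close>

lemma inv_into_derivative:
  fixes \<phi> :: "'a::euclidean_space \<Rightarrow> 'b::euclidean_space"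
  assumes "open U" "open V" "bij_betw \<phi> U V" "smooth_on U \<phi>" "smooth_on V (inv_into U \<phi>)" "x \<in> U"
  shows "frechet_derivative (inv_into U \<phi>) (at (\<phi> x)) (frechet_derivative \<phi> (at x) u) = u"
    and "frechet_derivative \<phi> (at x) (frechet_derivative (inv_into U \<phi>) (at (\<phi> x)) v) = v"
proof -
  have V: "\<phi> x \<in> V" using assms(3,6) bij_betwE by blast
  have inv: "inv_into U \<phi> (\<phi> y) = y" if "y \<in> U" for y
    using assms(3) that by (simp add: bij_betw_def)
  have inv2: "\<phi> (inv_into U \<phi> y) = y" if "y \<in> V" for y
    using assms(3) that by (metis bij_betw_inv_into_right)
  note d1 = smooth_on_has_derivative[OF assms(4,6)] and d2 = smooth_on_has_derivative[OF assms(5) V]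
  have "((\<lambda>x. x) has_derivative (\<lambda>u. frechet_derivative (inv_into U \<phi>) (at (\<phi> x)) (frechet_derivative \<phi> (at x) u))) (at x)"
    by (rule has_derivative_transform_within_open[OF has_derivative_compose[OF d1 d2] assms(1,6)]) (rule inv)
  from has_derivative_unique[OF this has_derivative_ident]
  show "frechet_derivative (inv_into U \<phi>) (at (\<phi> x)) (frechet_derivative \<phi> (at x) u) = u" by metis
  have d1': "(\<phi> has_derivative frechet_derivative \<phi> (at x)) (at (inv_into U \<phi> (\<phi> x)))"
    using d1 inv[OF assms(6)] by simp
  have "((\<lambda>y. y) has_derivative (\<lambda>v. frechet_derivative \<phi> (at x) (frechet_derivative (inv_into U \<phi>) (at (\<phi> x)) v))) (at (\<phi> x))"
    by (rule has_derivative_transform_within_open[OF has_derivative_compose[OF d2 d1'] assms(2) V]) (rule inv2)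
  from has_derivative_unique[OF this has_derivative_ident]
  show "frechet_derivative \<phi> (at x) (frechet_derivative (inv_into U \<phi>) (at (\<phi> x)) v) = v" by metis
qed

lemma local_affine_isometryD:
  assumes "local_affine_isometry M N U V \<phi>"
  shows "open U" "U \<subseteq> points M" "open V" "V \<subseteq> points N" "bij_betw \<phi> U V" "smooth_on U \<phi>"
    "smooth_on V (inv_into U \<phi>)"
    and "p \<in> U \<Longrightarrow> metric N (\<phi> p) (frechet_derivative \<phi> (at p) u) (frechet_derivative \<phi> (at p) v) = metric M p u v"
    and "p \<in> U \<Longrightarrow> torsion N (\<phi> p) (frechet_derivative \<phi> (at p) u) (frechet_derivative \<phi> (at p) v) =
      frechet_derivative \<phi> (at p) (torsion M p u v)"
  using assms unfolding local_affine_isometry_def Let_def by auto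

text \<open>One chart followed by the inverse of the other, restricted to the part of
  \<open>U\<close> whose image meets both ranges.\<close>

lemma local_affine_isometry_via:
  assumes \<phi>: "local_affine_isometry M K U V \<phi>" and p: "p \<in> U"
    and \<psi>: "local_affine_isometry N K U' V' \<psi>" and q: "q \<in> U'" and pq: "\<phi> p = \<psi> q"
  obtains U'' V'' \<theta> where "local_affine_isometry M N U'' V'' \<theta>" "p \<in> U''" "\<theta> p = q"
proof -
  note M = local_affine_isometryD[OF \<phi>] and N = local_affine_isometryD[OF \<psi>]
  define f g where "f = inv_into U \<phi>" and "g = inv_into U' \<psi>"
  define \<theta> where "\<theta> x = g (\<phi> x)" for x
  define W where "W = U \<inter> \<phi> -` V'"
  define W' where "W' = U' \<inter> \<psi> -` V"
  have f: "f (\<phi> x) = x" if "x \<in> U" for x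
    using M(5) that by (simp add: f_def bij_betw_def)
  have g: "g (\<psi> x) = x" if "x \<in> U'" for x
    using N(5) that by (simp add: g_def bij_betw_def)
  have f2: "f y \<in> U" "\<phi> (f y) = y" if "y \<in> V" for y
    using M(5) that by (auto simp: f_def bij_betw_def inv_into_into f_inv_into_f)
  have g2: "g y \<in> U'" "\<psi> (g y) = y" if "y \<in> V'" for y
    using N(5) that by (auto simp: g_def bij_betw_def inv_into_into f_inv_into_f)
  have UV: "\<phi> x \<in> V" if "x \<in> U" for x using M(5) that bij_betwE by blast
  have UV': "\<psi> x \<in> V'" if "x \<in> U'" for x using N(5) that bij_betwE by blast
  have W: "open W" "W \<subseteq> U" and W': "open W'" "W' \<subseteq> U'"
    unfolding W_def W'_def
    using smooth_on_continuous_on[OF M(6)] smooth_on_continuous_on[OF N(6)] M N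
    by (auto intro: continuous_open_preimage)
  have bij: "bij_betw \<theta> W W'"
    by (rule bij_betw_byWitness[where f' = "\<lambda>y. f (\<psi> y)"])
      (auto simp: W_def W'_def \<theta>_def f g f2 g2 UV UV')
  have sm: "smooth_on W \<theta>" unfolding \<theta>_def
    by (rule smooth_on_compose[OF W(1) N(7)[folded g_def] smooth_on_subset[OF M(6) W(2)]])
      (auto simp: W_def)
  have "inv_into W \<theta> y = f (\<psi> y)" if "y \<in> W'" for y
  proof -
    have "f (\<psi> y) \<in> W" "\<theta> (f (\<psi> y)) = y" using that by (auto simp: W_def W'_def \<theta>_def f2 g UV')
    then show ?thesis using bij inv_into_f_f[of \<theta> W "f (\<psi> y)"] by (simp add: bij_betw_def)
  qed
  moreover have "smooth_on W' (\<lambda>y. f (\<psi> y))"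
    by (rule smooth_on_compose[OF W'(1) M(7)[folded f_def] smooth_on_subset[OF N(6) W'(2)]])
      (auto simp: W'_def)
  ultimately have sm': "smooth_on W' (inv_into W \<theta>)"
    using smooth_on_cong[OF W'(1)] by (metis (no_types, lifting))
  have "local_affine_isometry M N W W' \<theta>"
    unfolding local_affine_isometry_def Let_def
  proof (intro conjI ballI allI)
    show "W \<subseteq> points M" "W' \<subseteq> points N" using W W' M N by blast+
    fix x u v assume x: "x \<in> W"
    have xs: "x \<in> U" "\<theta> x \<in> U'" "\<psi> (\<theta> x) = \<phi> x" using x by (auto simp: W_def \<theta>_def g2)
    let ?d\<theta> = "frechet_derivative \<theta> (at x)" and ?d\<psi> = "frechet_derivative \<psi> (at (\<theta> x))"
      and ?d\<phi> = "frechet_derivative \<phi> (at x)"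
    \<comment> \<open>Since \<psi> after \<theta> is \<phi>, the derivatives compose, and both
      invariance equations reduce to those of \<phi> and \<psi>; for the torsion the injective
      derivative of \<psi> is cancelled.\<close>
    have "(\<phi> has_derivative (\<lambda>u. ?d\<psi> (?d\<theta> u))) (at x)"
      by (rule has_derivative_transform_within_open[OF has_derivative_compose[OF
              smooth_on_has_derivative[OF sm x] smooth_on_has_derivative[OF N(6) xs(2)]] W(1) x])
        (auto simp: W_def \<theta>_def g2)
    then have d: "?d\<psi> (?d\<theta> u) = ?d\<phi> u" for u
      using frechet_derivative_at by metis
    have inj: "a = b" if "?d\<psi> a = ?d\<psi> b" for a b
      using inv_into_derivative(1)[OF N(1,3,5,6,7) xs(2)] that by metis
    show "metric N (\<theta> x) (?d\<theta> u) (?d\<theta> v) = metric M x u v"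
      using M(8)[OF xs(1), of u v] N(8)[OF xs(2), of "?d\<theta> u" "?d\<theta> v"] by (simp add: d xs)
    show "torsion N (\<theta> x) (?d\<theta> u) (?d\<theta> v) = ?d\<theta> (torsion M x u v)"
      by (rule inj)
        (use M(9)[OF xs(1), of u v] N(9)[OF xs(2), of "?d\<theta> u" "?d\<theta> v"] in \<open>simp only: d xs(3)\<close>)
  qed (use W W' bij sm sm' in auto)
  moreover have "p \<in> W" "\<theta> p = q" using p q pq UV' by (auto simp: W_def \<theta>_def g)
  ultimately show ?thesis by (rule that)
qed

lemma local_affine_isometryI:
  assumes U: "open U" "p \<in> U" "U \<subseteq> points M" and N: "\<phi> ` U \<subseteq> points N"
    and \<phi>: "smooth_on U \<phi>"
    and K: "\<And>v. smooth_on U (\<lambda>x. K x v)"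
    and KJ: "\<And>x v. x \<in> U \<Longrightarrow> K x (frechet_derivative \<phi> (at x) v) = v"
    and JK: "\<And>x v. x \<in> U \<Longrightarrow> frechet_derivative \<phi> (at x) (K x v) = v"
    and iso: "\<And>x u v. x \<in> U \<Longrightarrow>
      metric N (\<phi> x) (frechet_derivative \<phi> (at x) u) (frechet_derivative \<phi> (at x) v) = metric M x u v"
      "\<And>x u v. x \<in> U \<Longrightarrow> torsion N (\<phi> x) (frechet_derivative \<phi> (at x) u) (frechet_derivative \<phi> (at x) v) =
        frechet_derivative \<phi> (at x) (torsion M x u v)"
  obtains U' V' where "local_affine_isometry M N U' V' \<phi>" "p \<in> U'"
proof -
  obtain U' V where *: "open U'" "U' \<subseteq> U" "p \<in> U'" "open V" "bij_betw \<phi> U' V" "smooth_on V (inv_into U' \<phi>)"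
    using smooth_local_inverse[OF U(1,2) \<phi> K KJ JK] by blast
  have "V \<subseteq> points N" using * N by (auto simp: bij_betw_def)
  then have "local_affine_isometry M N U' V \<phi>"
    unfolding local_affine_isometry_def Let_def
    using * U iso smooth_on_subset[OF \<phi> *(2)] by (auto simp: subset_iff)
  with *(3) show ?thesis by (rule that[rotated])
qed

text \<open>The surface of curvature - m2 (a sphere, plane or hyperboloid sheet), projected
  orthogonally from its quadric to the tangent plane at one point: \<open>p $ 2\<close> and
  \<open>p $ 3\<close> are the ambient coordinates A and B, and \<open>sqrt (\<rho> p)\<close> is w.
  The form added to dt in \<theta> is \<Omega> times the rotationally symmetric potential of the
  area form; dividing dA dB by w gives the area form itself, hence the torsion.\<close>

definition model_rc :: "real \<Rightarrow> real \<Rightarrow> real \<Rightarrow> rc_space" where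
  "model_rc m2 \<Omega> S0 = (let \<rho> = (\<lambda>p. 1 + m2 * ((p $ 2)\<^sup>2 + (p $ 3)\<^sup>2));
      \<theta> = (\<lambda>p u. u $ 1 + \<Omega> * (p $ 2 * u $ 3 - p $ 3 * u $ 2) / (1 + sqrt (\<rho> p)));
      r = (\<lambda>p u. p $ 2 * u $ 2 + p $ 3 * u $ 3)
    in \<lparr>points = {p. \<rho> p > 0},
     metric = (\<lambda>p u v. \<theta> p u * \<theta> p v
       - (u $ 2 * v $ 2 + u $ 3 * v $ 3 - m2 * (r p u * r p v) / \<rho> p) - u $ 4 * v $ 4),
     torsion = (\<lambda>p u v. vec4 (S0 * (u $ 2 * v $ 3 - u $ 3 * v $ 2) / sqrt (\<rho> p)) 0 0 0)\<rparr>)"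

context goedel_constant
begin

text \<open>With c, h for \<open>cosk\<close> and \<open>sink\<close>, the expressions D c - D' h
  and D' c - m2 D h are constant, and c^2 - m2 h^2 = 1 allows them to be solved for D and D'. The
  closed form makes the identities of the surface purely polynomial.\<close>

lemma D_eq:
  assumes x0: "x0 \<in> I" and x: "x \<in> I"
  shows "D x = D x0 * cosk m2 (x - x0) + D' x0 * sink m2 (x - x0)"
    and "D' x = m2 * D x0 * sink m2 (x - x0) + D' x0 * cosk m2 (x - x0)"
proof -
  let ?c = "\<lambda>x. cosk m2 (x - x0)" and ?h = "\<lambda>x. sink m2 (x - x0)"
  have d: "(?c has_real_derivative m2 * ?h x) (at x)" "(?h has_real_derivative ?c x) (at x)" for x
    by (rule derivative_eq_intros refl | simp)+
  obtain a where a: "\<And>x. x \<in> I \<Longrightarrow> D x * ?c x - D' x * ?h x = a"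
    by (rule constant_on_I[of "\<lambda>x. D x * ?c x - D' x * ?h x"])
      (auto intro!: derivative_eq_intros d DERIV_D DERIV_D' simp: algebra_simps)
  obtain b where b: "\<And>x. x \<in> I \<Longrightarrow> D' x * ?c x - m2 * D x * ?h x = b"
    by (rule constant_on_I[of "\<lambda>x. D' x * ?c x - m2 * D x * ?h x"])
      (auto intro!: derivative_eq_intros d DERIV_D DERIV_D' simp: algebra_simps)
  have "a = D x0" "b = D' x0" using a[OF x0] b[OF x0] by auto
  then have *: "D x * ?c x - D' x * ?h x = D x0" "D' x * ?c x - m2 * D x * ?h x = D' x0"
    "(?c x)\<^sup>2 - m2 * (?h x)\<^sup>2 = 1"
    using a[OF x] b[OF x] cosk_squared by auto
  have "D x = D x * ((?c x)\<^sup>2 - m2 * (?h x)\<^sup>2)" "D' x = D' x * ((?c x)\<^sup>2 - m2 * (?h x)\<^sup>2)"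
    using *(3) by simp_all
  then show "D x = D x0 * ?c x + D' x0 * ?h x" "D' x = m2 * D x0 * ?h x + D' x0 * ?c x"
    unfolding *(1,2)[symmetric] by (simp_all add: algebra_simps power2_eq_square)
qed

text \<open>
  In the chart, the second and third coordinates \<open>A\<close>, \<open>B\<close> and \<open>w\<close> solve
  \<open>Hess f = m2 f g\<close> on the surface \<open>g = dx\<^sup>2 + D\<^sup>2 dy\<^sup>2\<close> of curvature \<open>- m2\<close>, normalised at the given point;
  the metric coefficients in these coordinates hence depend on the curvature only. The first
  coordinate is shifted by a primitive of \<open>H dy - \<Omega> (A dB - B dA) / (1 + w)\<close>, which is closed as
  \<open>d ((A dB - B dA) / (1 + w))\<close> is the area form.
\<close>

lemma local_affine_isometry_model:
  assumes p: "p \<in> points M"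
  obtains U V \<phi> where "local_affine_isometry M (model_rc m2 \<Omega> S0) U V \<phi>" "p \<in> U" "\<phi> p = 0"
proof -
  define x0 y0 D0 D1 where "x0 = p $ 2" and "y0 = p $ 3" and "D0 = D x0" and "D1 = D' x0"
  have x0: "x0 \<in> I" and p_pts: "p \<in> pts" using p by (auto simp: x0_def)
  define \<kappa> where "\<kappa> = m2 * D0\<^sup>2 - D1\<^sup>2"
  define c h C s E where "c q = cosk m2 (q $ 2 - x0)" and "h q = sink m2 (q $ 2 - x0)"
    and "C q = cosk \<kappa> (q $ 3 - y0)" and "s q = sink \<kappa> (q $ 3 - y0)" and "E q = versk \<kappa> (q $ 3 - y0)"
    for q :: "real^4"
  define d d' where "d q = D0 * c q + D1 * h q" and "d' q = m2 * D0 * h q + D1 * c q" for q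
  define A Ax Ay B Bx By w ex ey where
    "A q = h q - D1 * d q * E q" and "Ax q = c q - D1 * d' q * E q" and "Ay q = - (D1 * d q * s q)"
    and "B q = d q * s q" and "Bx q = d' q * s q" and "By q = d q * C q"
    and "w q = c q + m2 * D0 * d q * E q" and "ex q = h q + D0 * d' q * E q" and "ey q = D0 * d q * s q" for q
  define \<eta> where "\<eta> q = d q * (h q * C q + D1 * d q * E q)" for q
  have Cq: "C q = 1 + \<kappa> * E q" for q by (simp add: C_def E_def cosk_eq)
  note ids = surface_identities[of "c q" m2 "h q" "s q" "E q" D0 D1 for q,
      folded \<kappa>_def d_def d'_def Cq, folded A_def Ax_def Ay_def B_def Bx_def By_def w_def ex_def ey_def]
  have csq: "(c q)\<^sup>2 = 1 + m2 * (h q)\<^sup>2" "(s q)\<^sup>2 = E q * (C q + 1)" for q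
    using cosk_squared[of m2 "q $ 2 - x0"]
    by (simp_all add: c_def h_def s_def E_def C_def sink_squared)
  note ids = ids[OF csq]
  have dD: "d q = D (q $ 2)" if "q \<in> pts" for q
    using D_eq(1)[OF x0] that by (simp add: d_def D0_def D1_def c_def h_def)
  have der: "(c has_derivative (\<lambda>u. m2 * h q * u $ 2)) (at q)" "(h has_derivative (\<lambda>u. c q * u $ 2)) (at q)"
      "(C has_derivative (\<lambda>u. \<kappa> * s q * u $ 3)) (at q)" "(s has_derivative (\<lambda>u. C q * u $ 3)) (at q)"
      "(E has_derivative (\<lambda>u. s q * u $ 3)) (at q)" for q
    unfolding c_def[abs_def] h_def[abs_def] C_def[abs_def] s_def[abs_def] E_def[abs_def]
    by (rule derivative_eq_intros refl | simp add: ac_simps)+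
  have der_d: "(d has_derivative (\<lambda>u. d' q * u $ 2)) (at q)" for q
    unfolding d_def[abs_def] d'_def[abs_def]
    by (rule derivative_eq_intros der refl)+ (simp add: algebra_simps)
  have der_A: "(A has_derivative (\<lambda>u. Ax q * u $ 2 + Ay q * u $ 3)) (at q)" for q
    unfolding A_def[abs_def] Ax_def Ay_def
    by (rule derivative_eq_intros der der_d refl)+ (simp add: algebra_simps)
  have der_B: "(B has_derivative (\<lambda>u. Bx q * u $ 2 + By q * u $ 3)) (at q)" for q
    unfolding B_def[abs_def] Bx_def By_def
    by (rule derivative_eq_intros der der_d refl)+ (simp add: algebra_simps)
  have der_w: "(w has_derivative (\<lambda>u. m2 * ex q * u $ 2 + m2 * ey q * u $ 3)) (at q)" for q
    unfolding w_def[abs_def] ex_def ey_def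
    by (rule derivative_eq_intros der der_d refl)+ (simp add: algebra_simps)
  have der_\<eta>: "(\<eta> has_derivative (\<lambda>u. (d' q * (h q * C q + D1 * d q * E q) + d q * (c q * C q + D1 * d' q * E q)) * u $ 2 +
      d q * (h q * (\<kappa> * s q) + D1 * d q * s q) * u $ 3)) (at q)" for q
    unfolding \<eta>_def[abs_def]
    by (rule derivative_eq_intros der der_d refl)+ (simp add: algebra_simps)
  have sm0: "smooth_on UNIV c" "smooth_on UNIV h" "smooth_on UNIV C" "smooth_on UNIV s" "smooth_on UNIV E"
    unfolding c_def[abs_def] h_def[abs_def] C_def[abs_def] s_def[abs_def] E_def[abs_def]
    by (intro smooth_intros open_UNIV)+
  have sm1: "smooth_on UNIV d" "smooth_on UNIV d'"
    unfolding d_def[abs_def] d'_def[abs_def] by (intro smooth_intros sm0 open_UNIV)+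
  have sm2: "smooth_on UNIV A" "smooth_on UNIV B" "smooth_on UNIV w" "smooth_on UNIV \<eta>"
    "smooth_on UNIV Ax" "smooth_on UNIV Ay" "smooth_on UNIV Bx" "smooth_on UNIV By"
    unfolding A_def[abs_def] B_def[abs_def] w_def[abs_def] \<eta>_def[abs_def] Ax_def[abs_def] Ay_def[abs_def]
      Bx_def[abs_def] By_def[abs_def]
    by (intro smooth_intros sm0 sm1 open_UNIV)+
  \<comment> \<open>Positivity of \<open>w\<close> selects the root \<open>w q = sqrt \<rho>\<close>
    occurring in the model and keeps \<open>1 + w q\<close> and the Jacobian determinant nonzero.
    The neighbourhood is a ball because the Poincare lemma asks for convexity.\<close>
  have "w p = 1" by (simp add: w_def c_def E_def x0_def y0_def)
  then have "p \<in> pts \<inter> w -` {0<..}" using p_pts by simp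
  moreover have "open (pts \<inter> w -` {0<..})"
    using smooth_on_continuous_on[OF smooth_on_subset[OF sm2(3)], of pts] open_pts
    by (intro continuous_open_preimage) auto
  ultimately obtain e where e: "e > 0" "ball p e \<subseteq> pts \<inter> w -` {0<..}"
    by (meson open_contains_ball)
  define U where "U = ball p e"
  have U: "open U" "convex U" "p \<in> U" using e by (auto simp: U_def)
  have Upts: "q \<in> pts" and wpos: "w q > 0" if "q \<in> U" for q using e that by (auto simp: U_def)
  have dnz: "d q \<noteq> 0" if "q \<in> U" for q using dD[OF Upts[OF that]] D_nz Upts[OF that] by auto
  note smU = sm0[THEN smooth_on_subset[OF _ subset_UNIV[of U]]] sm1[THEN smooth_on_subset[OF _ subset_UNIV[of U]]]
    sm2[THEN smooth_on_subset[OF _ subset_UNIV[of U]]]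
  \<comment> \<open>Components along dx and dy of the form to be integrated; those of A dB - B dA
    are \<open>- D0 * s q\<close> and \<open>\<eta> q\<close>.\<close>
  define \<alpha>x where "\<alpha>x q = \<Omega> * D0 * s q / (1 + w q)" for q
  define \<alpha>y where "\<alpha>y q = H (q $ 2) - \<Omega> * \<eta> q / (1 + w q)" for q
  define F where "F q = vec4 0 (\<alpha>x q) (\<alpha>y q) 0" for q
  have smH: "smooth_on U (\<lambda>q. H (q $ 2))"
    using smooth_on_subset[OF smooth_on_nth2[OF smooth(1)]] Upts by blast
  have w1: "1 + w q \<noteq> 0" if "q \<in> U" for q using wpos[OF that] by simp
  have sm\<alpha>: "smooth_on U \<alpha>x" "smooth_on U \<alpha>y"
    unfolding \<alpha>x_def[abs_def] \<alpha>y_def[abs_def] by (intro smooth_intros U(1) smU smH w1; simp)+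
  have smF: "smooth_on U F"
    unfolding F_def[abs_def] by (intro smooth_intros U(1) sm\<alpha>)
  define \<eta>x where "\<eta>x q = d' q * (h q * C q + D1 * d q * E q) + d q * (c q * C q + D1 * d' q * E q)" for q
  define \<eta>y where "\<eta>y q = d q * (h q * (\<kappa> * s q) + D1 * d q * s q)" for q
  have dF: "(F has_derivative (\<lambda>u. vec4 0
      (\<Omega> * D0 * (C q * (1 + w q) * u $ 3 - s q * (m2 * ex q * u $ 2 + m2 * ey q * u $ 3)) / (1 + w q)\<^sup>2)
      (\<Omega> * d q * u $ 2 - \<Omega> * ((\<eta>x q * u $ 2 + \<eta>y q * u $ 3) * (1 + w q)
        - \<eta> q * (m2 * ex q * u $ 2 + m2 * ey q * u $ 3)) / (1 + w q)\<^sup>2) 0)) (at q)"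
    if q: "q \<in> U" for q
  proof -
    have qI: "q $ 2 \<in> I" using Upts[OF q] by simp
    show ?thesis
      unfolding F_def[abs_def] \<alpha>x_def[abs_def] \<alpha>y_def[abs_def]
      by (rule derivative_eq_intros der der_w der_\<eta>[folded \<eta>x_def \<eta>y_def] DERIV_vec_nth[OF DERIV_H[OF qI]] w1[OF q] refl)+
        (use w1[OF q] in \<open>auto simp: fun_eq_iff vec4_eq_iff dD[OF Upts[OF q]] power2_eq_square field_simps\<close>)
  qed
  have closed: "frechet_derivative F (at q) u \<bullet> v = frechet_derivative F (at q) v \<bullet> u" if q: "q \<in> U" for q u v
  proof -
    \<comment> \<open>The mixed partial derivatives agree because H dy and \<Omega> (A dB - B dA) /
      (1 + w) have the same exterior derivative \<Omega> D dx dy. For the second form this is the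
      last of the \<open>surface_identities\<close>.\<close>
    have "D0 * (C q * (1 + w q) - s q * (m2 * ey q)) = d q * (1 + w q)\<^sup>2 - (\<eta>x q * (1 + w q) - \<eta> q * (m2 * ex q))"
      using ids(10)[of q] unfolding \<eta>x_def \<eta>_def ey_def by (simp add: mult.assoc)
    then have "\<Omega> * D0 * (C q * (1 + w q) - s q * (m2 * ey q)) / (1 + w q)\<^sup>2 =
        \<Omega> * (d q * (1 + w q)\<^sup>2 - (\<eta>x q * (1 + w q) - \<eta> q * (m2 * ex q))) / (1 + w q)\<^sup>2"
      by (simp only: mult.assoc)
    also have "\<dots> = \<Omega> * d q - \<Omega> * (\<eta>x q * (1 + w q) - \<eta> q * (m2 * ex q)) / (1 + w q)\<^sup>2"
      using w1[OF q] by (simp add: right_diff_distrib diff_divide_distrib)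
    finally have eq: "\<Omega> * D0 * (C q * (1 + w q) - s q * (m2 * ey q)) / (1 + w q)\<^sup>2 =
      \<Omega> * d q - \<Omega> * (\<eta>x q * (1 + w q) - \<eta> q * (m2 * ex q)) / (1 + w q)\<^sup>2" .
    define a where "a = - \<Omega> * D0 * (s q * m2 * ex q) / (1 + w q)\<^sup>2"
    define b where "b = \<Omega> * D0 * (C q * (1 + w q) - s q * (m2 * ey q)) / (1 + w q)\<^sup>2"
    define e where "e = - \<Omega> * (\<eta>y q * (1 + w q) - \<eta> q * m2 * ey q) / (1 + w q)\<^sup>2"
    have "frechet_derivative F (at q) u \<bullet> v = (a * u $ 2 + b * u $ 3) * v $ 2 +
        ((\<Omega> * d q - \<Omega> * (\<eta>x q * (1 + w q) - \<eta> q * (m2 * ex q)) / (1 + w q)\<^sup>2) * u $ 2 + e * u $ 3) * v $ 3" for u v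
      unfolding frechet_derivative_at[OF dF[OF q], symmetric] a_def b_def e_def inner_vec_def sum_4
      by (simp add: algebra_simps add_divide_distrib diff_divide_distrib)
    then show ?thesis unfolding eq[symmetric] b_def[symmetric] by (simp add: algebra_simps)
  qed
  obtain \<sigma> where \<sigma>: "\<sigma> p = 0" "\<And>q. q \<in> U \<Longrightarrow> (\<sigma> has_derivative (\<lambda>v. F q \<bullet> v)) (at q)"
    using poincare_lemma_convex[OF U smF closed] by blast
  have F_inner: "F q \<bullet> u = \<alpha>x q * u $ 2 + \<alpha>y q * u $ 3" for q u
    by (simp add: F_def inner_vec_def sum_4)
  have sm\<sigma>: "smooth_on U \<sigma>"
    by (rule smooth_onI[OF U(1) \<sigma>(2)]) (simp_all add: F_inner, intro smooth_intros U(1) sm\<alpha>)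
  define \<phi> where "\<phi> q = vec4 (q $ 1 - p $ 1 + \<sigma> q) (A q) (B q) (q $ 4 - p $ 4)" for q
  have sm\<phi>: "smooth_on U \<phi>"
    unfolding \<phi>_def[abs_def] by (intro smooth_intros U(1) sm\<sigma> smU)
  have "(\<phi> has_derivative (\<lambda>u. vec4 (u $ 1 + (\<alpha>x q * u $ 2 + \<alpha>y q * u $ 3)) (Ax q * u $ 2 + Ay q * u $ 3)
      (Bx q * u $ 2 + By q * u $ 3) (u $ 4))) (at q)" if "q \<in> U" for q
    unfolding \<phi>_def[abs_def]
    by (rule derivative_eq_intros der_A der_B \<sigma>(2) that refl)+ (simp add: F_inner)
  note d\<phi> = frechet_derivative_at[OF this, symmetric]
  \<comment> \<open>Cramer's rule for the block in x and y, with determinant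
    \<open>w q * d q\<close>, followed by back substitution in the row of t.\<close>
  define K where "K q v = (let a = (By q * v $ 2 - Ay q * v $ 3) / (w q * d q); b = (Ax q * v $ 3 - Bx q * v $ 2) / (w q * d q)
    in vec4 (v $ 1 - (\<alpha>x q * a + \<alpha>y q * b)) a b (v $ 4))" for q and v :: "real^4"
  have wd: "w q * d q \<noteq> 0" if "q \<in> U" for q using wpos[OF that] dnz[OF that] by simp
  obtain U' V where UV: "local_affine_isometry M (model_rc m2 \<Omega> S0) U' V \<phi>" "p \<in> U'"
  proof (rule local_affine_isometryI[OF U(1) U(3) _ _ sm\<phi>, of M "model_rc m2 \<Omega> S0" K])
    show "U \<subseteq> points M" using Upts by auto
    have \<rho>: "1 + m2 * ((A q)\<^sup>2 + (B q)\<^sup>2) = (w q)\<^sup>2" for q using ids(1) by simp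
    show "\<phi> ` U \<subseteq> points (model_rc m2 \<Omega> S0)"
      using wpos by (auto simp: model_rc_def Let_def \<phi>_def \<rho>) (metis less_irrefl)
    show "smooth_on U (\<lambda>q. K q v)" for v
      unfolding K_def Let_def by (intro smooth_intros U(1) smU sm\<alpha> wd; assumption)
    fix q assume q: "q \<in> U"
    have det: "Ax q * By q - Ay q * Bx q = w q * d q" by (rule ids(7))
    show "K q (frechet_derivative \<phi> (at q) v) = v" for v
    proof -
      have "By q * (Ax q * v $ 2 + Ay q * v $ 3) - Ay q * (Bx q * v $ 2 + By q * v $ 3) = v $ 2 * (w q * d q)"
        "Ax q * (Bx q * v $ 2 + By q * v $ 3) - Bx q * (Ax q * v $ 2 + Ay q * v $ 3) = v $ 3 * (w q * d q)"
        using det by algebra+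
      then show ?thesis using wd[OF q] unfolding d\<phi>[OF q] K_def Let_def by (simp add: vec4_eq_iff)
    qed
    show "frechet_derivative \<phi> (at q) (K q v) = v" for v
    proof -
      have "Ax q * ((By q * v $ 2 - Ay q * v $ 3) / (w q * d q)) + Ay q * ((Ax q * v $ 3 - Bx q * v $ 2) / (w q * d q)) =
          v $ 2 * (Ax q * By q - Ay q * Bx q) / (w q * d q)"
        "Bx q * ((By q * v $ 2 - Ay q * v $ 3) / (w q * d q)) + By q * ((Ax q * v $ 3 - Bx q * v $ 2) / (w q * d q)) =
          v $ 3 * (Ax q * By q - Ay q * Bx q) / (w q * d q)"
        by (simp_all add: field_simps flip: add_divide_distrib diff_divide_distrib)
      then show ?thesis using wd[OF q] unfolding d\<phi>[OF q] K_def Let_def det by (simp add: vec4_eq_iff)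
    qed
    have sq: "\<bar>w q\<bar> = w q" using wpos[OF q] by simp
    have \<phi>q: "\<phi> q $ 2 = A q" "\<phi> q $ 3 = B q" by (simp_all add: \<phi>_def)
    have rr: "A q * (Ax q * u $ 2 + Ay q * u $ 3) + B q * (Bx q * u $ 2 + By q * u $ 3) =
        w q * (ex q * u $ 2 + ey q * u $ 3)" for u :: "real^4"
      using ids(2,3)[of q] by algebra
    have tt: "u $ 1 + (\<alpha>x q * u $ 2 + \<alpha>y q * u $ 3) + \<Omega> * (A q * (Bx q * u $ 2 + By q * u $ 3)
        - B q * (Ax q * u $ 2 + Ay q * u $ 3)) / (1 + w q) = u $ 1 + H (q $ 2) * u $ 3" for u :: "real^4"
    proof -
      have "A q * (Bx q * u $ 2 + By q * u $ 3) - B q * (Ax q * u $ 2 + Ay q * u $ 3) =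
          \<eta> q * u $ 3 - D0 * s q * u $ 2"
        using ids(8,9)[of q] unfolding \<eta>_def by algebra
      then show ?thesis unfolding \<alpha>x_def \<alpha>y_def
        by (simp only:) (simp add: field_simps add_divide_distrib diff_divide_distrib)
    qed
    show "metric (model_rc m2 \<Omega> S0) (\<phi> q) (frechet_derivative \<phi> (at q) u) (frechet_derivative \<phi> (at q) v) = metric M q u v"
      for u v
    proof -
      have "m2 * (w q * (ex q * u $ 2 + ey q * u $ 3) * (w q * (ex q * v $ 2 + ey q * v $ 3))) / (w q)\<^sup>2 =
          m2 * ((ex q * u $ 2 + ey q * u $ 3) * (ex q * v $ 2 + ey q * v $ 3))"
        using wpos[OF q] by (simp add: power2_eq_square field_simps)
      moreover have "(Ax q * u $ 2 + Ay q * u $ 3) * (Ax q * v $ 2 + Ay q * v $ 3) +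
          (Bx q * u $ 2 + By q * u $ 3) * (Bx q * v $ 2 + By q * v $ 3)
          - m2 * ((ex q * u $ 2 + ey q * u $ 3) * (ex q * v $ 2 + ey q * v $ 3)) =
          u $ 2 * v $ 2 + (d q)\<^sup>2 * (u $ 3 * v $ 3)"
        using ids(4,5,6)[of q] by algebra
      ultimately show ?thesis
        unfolding d\<phi>[OF q] model_rc_def Let_def
        by (simp add: \<phi>q \<rho> sq rr tt dD[OF Upts[OF q]])
    qed
    show "torsion (model_rc m2 \<Omega> S0) (\<phi> q) (frechet_derivative \<phi> (at q) u) (frechet_derivative \<phi> (at q) v) =
        frechet_derivative \<phi> (at q) (torsion M q u v)" for u v
    proof -
      have "(Ax q * u $ 2 + Ay q * u $ 3) * (Bx q * v $ 2 + By q * v $ 3)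
          - (Bx q * u $ 2 + By q * u $ 3) * (Ax q * v $ 2 + Ay q * v $ 3) = w q * d q * (u $ 2 * v $ 3 - u $ 3 * v $ 2)"
        using det by algebra
      then show ?thesis using wpos[OF q] S_eq Upts[OF q]
        unfolding d\<phi>[OF q] model_rc_def Let_def
        by (simp add: \<phi>q \<rho> sq vec4_eq_iff dD[OF Upts[OF q]])
    qed
  qed
  moreover have "\<phi> p = 0"
    by (simp add: \<phi>_def vec4_eq_iff \<sigma>(1) A_def B_def h_def E_def s_def x0_def y0_def)
  ultimately show ?thesis by (rule that)
qed

end

text \<open>Both points go to the origin of one model, which contains no data other than the three
  parameters. For two manifolds this yields local equivalence; for one manifold taken twice it
  yields homogeneity.\<close>

lemma goedel_constant_transitive:
  assumes "goedel_constant I J H D S D' m2 \<Omega> S0" "goedel_constant I2 J2 H2 D2 S2 D2' m2 \<Omega> S0"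
    and "p \<in> points (goedel_rc I J H D S)" "q \<in> points (goedel_rc I2 J2 H2 D2 S2)"
  obtains U V \<phi> where "local_affine_isometry (goedel_rc I J H D S) (goedel_rc I2 J2 H2 D2 S2) U V \<phi>"
    "p \<in> U" "\<phi> p = q"
  using goedel_constant.local_affine_isometry_model[OF assms(1,3)]
    goedel_constant.local_affine_isometry_model[OF assms(2,4)] local_affine_isometry_via
  by metis

context goedel_constant
begin

lemma locally_homogeneous: "locally_homogeneous M"
  unfolding locally_homogeneous_def
proof
  fix p assume p: "p \<in> points M"
  have "motion_orbit M p = points M"
  proof
    show "motion_orbit M p \<subseteq> points M"
      unfolding motion_orbit_def local_affine_isometry_def bij_betw_def by blast
    show "points M \<subseteq> motion_orbit M p"
    proof
      fix q assume "q \<in> points M"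
      then show "q \<in> motion_orbit M p" unfolding motion_orbit_def
        using goedel_constant_transitive[OF goedel_constant_axioms goedel_constant_axioms p] by blast
    qed
  qed
  then show "open (motion_orbit M p)" using open_pts by simp
qed

end

section \<open>Curvature and torsion invariants\<close>

text \<open>Serves twice: for the Ricci form, which is a trace of the curvature, and for the scalar
  curvature, which is the trace of the Ricci operator.\<close>

lemma trace_similar:
  fixes f g J K :: "real^'n \<Rightarrow> real^'n"
  assumes "linear f" "linear g" "linear J" "linear K"
    and "\<And>u. K (J u) = u" "\<And>u. g (J u) = J (f u)"
  shows "(\<Sum>i\<in>UNIV. f (axis i 1) $ i) = (\<Sum>i\<in>UNIV. g (axis i 1) $ i)"
proof -
  have *: "(\<Sum>i\<in>UNIV. h (axis i 1) $ i) = trace (matrix h)" for h :: "real^'n \<Rightarrow> real^'n"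
    by (simp add: trace_def matrix_def)
  have "J (K u) = u" for u
  proof -
    have "K \<circ> J = id" using assms by auto
    then have "J \<circ> K = id" using assms linear_inverse_left by blast
    then show ?thesis by (metis comp_apply id_apply)
  qed
  then have g: "g = J \<circ> f \<circ> K" using assms(6) by (metis comp_apply ext)
  have lin: "linear (f \<circ> K)" using assms linear_compose by blast
  have "trace (matrix g) = trace (matrix J ** matrix (f \<circ> K))"
    unfolding g using matrix_compose[OF lin assms(3)] by (simp add: comp_assoc)
  also have "\<dots> = trace (matrix (f \<circ> K) ** matrix J)" by (rule trace_mul_sym)
  also have "matrix (f \<circ> K) ** matrix J = matrix (f \<circ> K \<circ> J)"
    by (rule matrix_compose[symmetric, OF assms(3) lin])
  also have "f \<circ> K \<circ> J = f" using assms(5) by auto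
  finally show ?thesis unfolding * ..
qed

section \<open>The Ricci operator in coordinates\<close>

locale goedel =
  fixes I J :: "real set" and H D S :: "real \<Rightarrow> real"
  assumes data: "goedel_data I J H D S"
begin

lemma I: "open I" "is_interval I" "I \<noteq> {}" and J: "open J" "is_interval J" "J \<noteq> {}"
  and smooth: "smooth_on I H" "smooth_on I D" "smooth_on J S" and D_nz: "x \<in> I \<Longrightarrow> D x \<noteq> 0"
  using data by (auto simp: goedel_data_def open_interval_def)

abbreviation "M \<equiv> goedel_rc I J H D S"
abbreviation "H1 \<equiv> deriv H" abbreviation "H2 \<equiv> deriv H1"
abbreviation "D1 \<equiv> deriv D" abbreviation "D2 \<equiv> deriv D1"

lemmas smooth1 = smooth_on_deriv(2)[OF I(1) smooth(1)] smooth_on_deriv(2)[OF I(1) smooth(2)]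
lemmas smooth2 = smooth_on_deriv(2)[OF I(1) smooth1(1)] smooth_on_deriv(2)[OF I(1) smooth1(2)]
lemmas DERIV = smooth_on_deriv(1)[OF I(1) smooth(1)] smooth_on_deriv(1)[OF I(1) smooth(2)]
  smooth_on_deriv(1)[OF I(1) smooth1(1)] smooth_on_deriv(1)[OF I(1) smooth1(2)]

lemma has_derivative_nth2:
  assumes "(h has_real_derivative h') (at (f q $ 2))" "(f has_derivative f') (at q)"
  shows "((\<lambda>q. h (f q $ 2)) has_derivative (\<lambda>w. h' * f' w $ 2)) (at q)"
  using DERIV_compose_FDERIV[OF assms(1) has_derivative_vec_nth[OF assms(2)]] by (simp add: mult.commute)

text \<open>The Christoffel symbols \<open>chr\<close> of the Levi-Civita connection, with \<open>y\<close>-component \<open>\<gamma>\<close>, and their derivatives \<open>chr'\<close>, \<open>\<gamma>'\<close> along \<open>\<partial>\<^sub>x\<close>.\<close>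

definition \<gamma> :: "real^4 \<Rightarrow> real^4 \<Rightarrow> real^4 \<Rightarrow> real" where
  "\<gamma> p u v = - (H1 (p $ 2) / 2 * (u $ 2 * (v $ 1 + H (p $ 2) * v $ 3) + v $ 2 * (u $ 1 + H (p $ 2) * u $ 3))
     - D (p $ 2) * D1 (p $ 2) * (u $ 2 * v $ 3 + v $ 2 * u $ 3)) / (D (p $ 2))\<^sup>2"

definition \<gamma>' :: "real^4 \<Rightarrow> real^4 \<Rightarrow> real^4 \<Rightarrow> real" where
  "\<gamma>' p u v = - (H2 (p $ 2) / 2 * (u $ 2 * (v $ 1 + H (p $ 2) * v $ 3) + v $ 2 * (u $ 1 + H (p $ 2) * u $ 3))
     + (H1 (p $ 2))\<^sup>2 / 2 * (u $ 2 * v $ 3 + v $ 2 * u $ 3)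
     - ((D1 (p $ 2))\<^sup>2 + D (p $ 2) * D2 (p $ 2)) * (u $ 2 * v $ 3 + v $ 2 * u $ 3)) / (D (p $ 2))\<^sup>2
     - 2 * D1 (p $ 2) / D (p $ 2) * \<gamma> p u v"

definition chr :: "real^4 \<Rightarrow> real^4 \<Rightarrow> real^4 \<Rightarrow> real^4" where
  "chr p u v = vec4 (H1 (p $ 2) / 2 * (u $ 2 * v $ 3 + v $ 2 * u $ 3) - H (p $ 2) * \<gamma> p u v)
    (H1 (p $ 2) / 2 * (u $ 3 * (v $ 1 + H (p $ 2) * v $ 3) + v $ 3 * (u $ 1 + H (p $ 2) * u $ 3))
      - D (p $ 2) * D1 (p $ 2) * (u $ 3 * v $ 3)) (\<gamma> p u v) 0"

definition chr' :: "real^4 \<Rightarrow> real^4 \<Rightarrow> real^4 \<Rightarrow> real^4" where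
  "chr' p u v = vec4 (H2 (p $ 2) / 2 * (u $ 2 * v $ 3 + v $ 2 * u $ 3) - H1 (p $ 2) * \<gamma> p u v - H (p $ 2) * \<gamma>' p u v)
    (H2 (p $ 2) / 2 * (u $ 3 * (v $ 1 + H (p $ 2) * v $ 3) + v $ 3 * (u $ 1 + H (p $ 2) * u $ 3))
      + (H1 (p $ 2))\<^sup>2 * (u $ 3 * v $ 3)
      - ((D1 (p $ 2))\<^sup>2 + D (p $ 2) * D2 (p $ 2)) * (u $ 3 * v $ 3)) (\<gamma>' p u v) 0"

lemma linear_chr: "linear (chr p u)" "linear (\<lambda>u. chr p u v)"
  by (auto intro!: linearI simp: chr_def \<gamma>_def vec4_eq_iff algebra_simps add_divide_distrib diff_divide_distrib)

lemma linear_chr': "linear (chr' p u)" "linear (\<lambda>u. chr' p u v)"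
  by (auto intro!: linearI simp: chr'_def \<gamma>'_def \<gamma>_def vec4_eq_iff algebra_simps add_divide_distrib diff_divide_distrib)

lemma chr_commute: "chr p u v = chr p v u"
  by (simp add: chr_def \<gamma>_def vec4_eq_iff algebra_simps)

text \<open>Metric compatibility of \<open>chr\<close>, along a map \<open>f\<close> and for moving
  vectors: it is applied to the identity with constant vectors and to an isometry with the images of
  these vectors.\<close>

lemma has_derivative_metric:
  assumes p: "f x $ 2 \<in> I" and f: "(f has_derivative f') (at x)" and a: "(a has_derivative a') (at x)"
    and b: "(b has_derivative b') (at x)"
  shows "((\<lambda>q. metric M (f q) (a q) (b q)) has_derivative
    (\<lambda>w. metric M (f x) (chr (f x) (f' w) (a x)) (b x) + metric M (f x) (a x) (chr (f x) (f' w) (b x))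
      + metric M (f x) (a' w) (b x) + metric M (f x) (a x) (b' w))) (at x)"
proof -
  note d = has_derivative_nth2[OF DERIV(1)[OF p] f] has_derivative_nth2[OF DERIV(2)[OF p] f]
    has_derivative_vec_nth[OF a] has_derivative_vec_nth[OF b]
  show ?thesis unfolding goedel_rc_simps
    apply (rule derivative_eq_intros a b f d refl)+
    using D_nz[OF p] apply (simp add: chr_def \<gamma>_def fun_eq_iff)
    by (simp add: field_simps power2_eq_square)
qed

lemma has_derivative_chr:
  assumes p: "f x $ 2 \<in> I" and f: "(f has_derivative f') (at x)" and a: "(a has_derivative a') (at x)"
    and b: "(b has_derivative b') (at x)"
  shows "((\<lambda>q. chr (f q) (a q) (b q)) has_derivative (\<lambda>w. f' w $ 2 *\<^sub>R chr' (f x) (a x) (b x)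
    + chr (f x) (a' w) (b x) + chr (f x) (a x) (b' w))) (at x)"
proof -
  note d = has_derivative_nth2[OF DERIV(1)[OF p] f] has_derivative_nth2[OF DERIV(2)[OF p] f]
    has_derivative_nth2[OF DERIV(3)[OF p] f] has_derivative_nth2[OF DERIV(4)[OF p] f]
    has_derivative_vec_nth[OF a] has_derivative_vec_nth[OF b]
  have D: "(D (f x $ 2))\<^sup>2 \<noteq> 0" "D (f x $ 2) \<noteq> 0" "(2::real) \<noteq> 0" using D_nz[OF p] by auto
  have g: "((\<lambda>q. \<gamma> (f q) (a q) (b q)) has_derivative (\<lambda>w. f' w $ 2 * \<gamma>' (f x) (a x) (b x)
    + \<gamma> (f x) (a' w) (b x) + \<gamma> (f x) (a x) (b' w))) (at x)"
    unfolding \<gamma>_def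
    apply (rule derivative_eq_intros a b f d D refl)+
    using D apply (simp add: \<gamma>'_def \<gamma>_def fun_eq_iff)
    by (simp add: field_simps power2_eq_square)
  show ?thesis unfolding chr_def
    apply (rule derivative_eq_intros a b f d g D refl)+
    by (simp add: chr'_def vec4_eq_iff fun_eq_iff algebra_simps power2_eq_square)
qed

text \<open>Curvature of the connection \<open>chr\<close> on constant coordinate fields. The
  coefficients depend on x only, so their derivative along \<open>s\<close> is \<open>s $ 2\<close>
  times \<open>chr'\<close>.\<close>

definition riem :: "real^4 \<Rightarrow> real^4 \<Rightarrow> real^4 \<Rightarrow> real^4 \<Rightarrow> real^4" where
  "riem p s w u = s $ 2 *\<^sub>R chr' p w u - w $ 2 *\<^sub>R chr' p s u + chr p s (chr p w u) - chr p w (chr p s u)"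

definition ric :: "real^4 \<Rightarrow> real^4 \<Rightarrow> real^4 \<Rightarrow> real" where
  "ric p w u = (\<Sum>i\<in>UNIV. riem p (axis i 1) w u $ i)"

text \<open>With \<Omega> = H' / D, the three functions are \<Omega>^2 / 2, \<Omega>^2 / 2 - D'' / D
  and \<Omega>' / 2, the coefficients of the Ricci tensor in the coframe dt + H dy, dx, D dy. The
  off-diagonal \<delta> has to be carried along because \<Omega> is not yet known to be
  constant.\<close>

definition \<alpha> :: "real \<Rightarrow> real" where "\<alpha> x = (H1 x / D x)\<^sup>2 / 2"
definition \<beta> :: "real \<Rightarrow> real" where "\<beta> x = \<alpha> x - D2 x / D x"
definition \<delta> :: "real \<Rightarrow> real" where "\<delta> x = (H2 x * D x - H1 x * D1 x) / (D x)\<^sup>2 / 2"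

lemma ric_eq:
  assumes "p $ 2 \<in> I"
  defines "x \<equiv> p $ 2"
  shows "ric p w u = \<alpha> x * ((w $ 1 + H x * w $ 3) * (u $ 1 + H x * u $ 3)) + \<beta> x * (w $ 2 * u $ 2 + (D x)\<^sup>2 * (w $ 3 * u $ 3))
    + \<delta> x * D x * ((w $ 1 + H x * w $ 3) * u $ 3 + w $ 3 * (u $ 1 + H x * u $ 3))"
proof -
  have "D x \<noteq> 0" using assms D_nz by simp
  have ax: "axis 1 1 = vec4 1 0 0 0" "axis 2 1 = vec4 0 1 0 0" "axis 3 1 = vec4 0 0 1 0" "axis 4 1 = vec4 0 0 0 1"
    by (simp_all add: vec4_def)
  show ?thesis
    unfolding ric_def sum_4 ax riem_def
    apply (simp add: chr_def chr'_def \<gamma>'_def \<gamma>_def flip: x_def)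
    using \<open>D x \<noteq> 0\<close> apply (simp add: \<alpha>_def \<beta>_def \<delta>_def field_simps)
    by algebra
qed

text \<open>The Ricci tensor with one index raised. In the orthonormal frame its eigenvalue is -
  \<beta> along x and 0 along z; the block with rows (\<alpha>, \<delta>) and (- \<delta>, -
  \<beta>) mixes the direction of t with the one dual to D dy.\<close>

definition ricop :: "real^4 \<Rightarrow> real^4 \<Rightarrow> real^4" where
  "ricop p u = (let x = p $ 2; a = \<alpha> x * (u $ 1 + H x * u $ 3) + \<delta> x * D x * u $ 3;
     b = - \<delta> x * (u $ 1 + H x * u $ 3) / D x - \<beta> x * u $ 3 in vec4 (a - H x * b) (- \<beta> x * u $ 2) b 0)"

lemma metric_ricop:
  assumes "p $ 2 \<in> I"
  shows "metric M p (ricop p w) u = ric p w u"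
  using D_nz[OF assms] unfolding ric_eq[OF assms] ricop_def Let_def
  by (simp add: field_simps power2_eq_square)

lemma trace_ricop:
  assumes "p $ 2 \<in> I"
  shows "(\<Sum>i\<in>UNIV. ricop p (axis i 1) $ i) = \<alpha> (p $ 2) - 2 * \<beta> (p $ 2)"
proof -
  have ax: "axis 1 1 = vec4 1 0 0 0" "axis 2 1 = vec4 0 1 0 0" "axis 3 1 = vec4 0 0 1 0" "axis 4 1 = vec4 0 0 0 1"
    by (simp_all add: vec4_def)
  show ?thesis using D_nz[OF assms]
    unfolding sum_4 ax by (simp add: ricop_def Let_def field_simps)
qed

lemma linear_ricop: "linear (ricop p)"
  by (auto intro!: linearI simp: ricop_def Let_def vec4_eq_iff algebra_simps add_divide_distrib diff_divide_distrib)

lemma metric_nondegenerate: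
  assumes "p $ 2 \<in> I" "\<And>v. metric M p u v = metric M p u' v"
  shows "u = u'"
proof -
  have "u $ 1 + H (p $ 2) * u $ 3 = u' $ 1 + H (p $ 2) * u' $ 3" using assms(2)[of "vec4 1 0 0 0"] by simp
  moreover have "u $ 2 = u' $ 2" "u $ 4 = u' $ 4"
    using assms(2)[of "vec4 0 1 0 0"] assms(2)[of "vec4 0 0 0 1"] by simp_all
  moreover have "u $ 3 = u' $ 3"
    using assms(2)[of "vec4 (- H (p $ 2)) 0 1 0"] D_nz[OF assms(1)] by simp
  ultimately show ?thesis by (simp add: vec4_eq_iff)
qed

end

section \<open>Behaviour of curvature and torsion under isometries\<close>

locale goedel_isometry = goedel +
  fixes U V \<phi>
  assumes iso: "local_affine_isometry M M U V \<phi>"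
begin

lemmas isoD = local_affine_isometryD[OF iso]

abbreviation "d\<phi> q \<equiv> frechet_derivative \<phi> (at q)"
abbreviation "d2\<phi> q w u \<equiv> frechet_derivative (\<lambda>q. d\<phi> q u) (at q) w"
abbreviation "d3\<phi> q s w u \<equiv> frechet_derivative (\<lambda>q. d2\<phi> q w u) (at q) s"

lemma U_I: "q \<in> U \<Longrightarrow> q $ 2 \<in> I" "q \<in> U \<Longrightarrow> \<phi> q $ 2 \<in> I"
  using isoD(2,4) bij_betwE[OF isoD(5)] by fastforce+

lemma smooth_d\<phi>: "smooth_on U (\<lambda>q. d\<phi> q u)" "smooth_on U (\<lambda>q. d2\<phi> q w u)"
  by (intro smooth_on_frechet_derivative isoD(6))+

lemma has_derivative_\<phi>: "q \<in> U \<Longrightarrow> (\<phi> has_derivative d\<phi> q) (at q)"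
  "q \<in> U \<Longrightarrow> ((\<lambda>q. d\<phi> q u) has_derivative (\<lambda>w. d2\<phi> q w u)) (at q)"
  "q \<in> U \<Longrightarrow> ((\<lambda>q. d2\<phi> q w u) has_derivative (\<lambda>s. d3\<phi> q s w u)) (at q)"
  using smooth_on_has_derivative isoD(6) smooth_d\<phi> by blast+

lemma d2\<phi>_commute: "q \<in> U \<Longrightarrow> d2\<phi> q w u = d2\<phi> q u w"
  by (rule smooth_on_symmetric[OF isoD(1,6)])

lemma d3\<phi>_commute: "q \<in> U \<Longrightarrow> d3\<phi> q s w u = d3\<phi> q w s u"
  by (rule smooth_on_symmetric[OF isoD(1) smooth_d\<phi>(1)])

lemma linear_d\<phi>: "q \<in> U \<Longrightarrow> linear (d\<phi> q)"
  using has_derivative_\<phi>(1) has_derivative_linear by blast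

lemma linear_d2\<phi>:
  assumes "q \<in> U"
  shows "linear (d2\<phi> q w)"
proof -
  have "(\<lambda>u. d2\<phi> q w u) = (\<lambda>u. d2\<phi> q u w)" using d2\<phi>_commute[OF assms] by blast
  then show ?thesis using has_derivative_linear[OF has_derivative_\<phi>(2)[OF assms]] by simp
qed

abbreviation "\<psi> q \<equiv> frechet_derivative (inv_into U \<phi>) (at (\<phi> q))"

lemma \<psi>: "q \<in> U \<Longrightarrow> \<psi> q (d\<phi> q u) = u" "q \<in> U \<Longrightarrow> d\<phi> q (\<psi> q v) = v"
  using inv_into_derivative[OF isoD(1,3,5,6,7)] by blast+

lemma linear_\<psi>: "q \<in> U \<Longrightarrow> linear (\<psi> q)"
  using smooth_on_has_derivative[OF isoD(7)] bij_betwE[OF isoD(5)] has_derivative_linear by blast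

lemma metric_linear:
  "metric M p (u + v) w = metric M p u w + metric M p v w" "metric M p w (u + v) = metric M p w u + metric M p w v"
  "metric M p (u - v) w = metric M p u w - metric M p v w" "metric M p w (u - v) = metric M p w u - metric M p w v"
  "metric M p u w = metric M p w u"
  by (simp_all add: algebra_simps)

text \<open>The permutation argument for the uniqueness of the Levi-Civita connection.\<close>

lemma d2\<phi>_eq:
  assumes q: "q \<in> U"
  shows "d2\<phi> q w u = d\<phi> q (chr q w u) - chr (\<phi> q) (d\<phi> q w) (d\<phi> q u)"
proof -
  define T where "T w u = d2\<phi> q w u + chr (\<phi> q) (d\<phi> q w) (d\<phi> q u) - d\<phi> q (chr q w u)" for w u
  define t where "t w u v = metric M (\<phi> q) (T w u) (d\<phi> q v)" for w u v
  \<comment> \<open>\<open>T\<close> measures the failure of \<phi> to be affine. When the isometry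
    equation is differentiated on both sides, the terms with \<open>chr q\<close> are carried over
    by \<phi>, and skewness of \<open>t\<close> in its last two slots is what remains.\<close>
  have "t w u v = - t w v u" for w u v
  proof -
    let ?g = "metric M (\<phi> q)"
    have "((\<lambda>q. metric M q u v) has_derivative (\<lambda>w. metric M q (chr q w u) v + metric M q u (chr q w v)
        + metric M q 0 v + metric M q u 0)) (at q)"
      by (rule has_derivative_metric[where f = "\<lambda>q. q" and a = "\<lambda>_. u" and b = "\<lambda>_. v"])
        (use U_I(1)[OF q] in auto)
    then have "((\<lambda>q. metric M (\<phi> q) (d\<phi> q u) (d\<phi> q v)) has_derivative
        (\<lambda>w. metric M q (chr q w u) v + metric M q u (chr q w v) + metric M q 0 v + metric M q u 0)) (at q)"
      by (rule has_derivative_transform_within_open[OF _ isoD(1) q]) (simp only: isoD(8))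
    moreover have "((\<lambda>q. metric M (\<phi> q) (d\<phi> q u) (d\<phi> q v)) has_derivative (\<lambda>w.
        ?g (chr (\<phi> q) (d\<phi> q w) (d\<phi> q u)) (d\<phi> q v) + ?g (d\<phi> q u) (chr (\<phi> q) (d\<phi> q w) (d\<phi> q v))
        + ?g (d2\<phi> q w u) (d\<phi> q v) + ?g (d\<phi> q u) (d2\<phi> q w v))) (at q)"
      by (rule has_derivative_metric[where f = \<phi> and a = "\<lambda>q. d\<phi> q u" and b = "\<lambda>q. d\<phi> q v" and x = q
            and f' = "d\<phi> q" and a' = "\<lambda>w. d2\<phi> q w u" and b' = "\<lambda>w. d2\<phi> q w v",
            OF U_I(2)[OF q] has_derivative_\<phi>(1)[OF q] has_derivative_\<phi>(2)[OF q] has_derivative_\<phi>(2)[OF q]])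
    from has_derivative_unique[OF calculation this]
    have "metric M q (chr q w u) v + metric M q u (chr q w v) + metric M q 0 v + metric M q u 0 =
        ?g (chr (\<phi> q) (d\<phi> q w) (d\<phi> q u)) (d\<phi> q v) + ?g (d\<phi> q u) (chr (\<phi> q) (d\<phi> q w) (d\<phi> q v))
        + ?g (d2\<phi> q w u) (d\<phi> q v) + ?g (d\<phi> q u) (d2\<phi> q w v)"
      by (rule fun_cong)
    moreover have "metric M q 0 v = 0" "metric M q u 0 = 0" by simp_all
    ultimately show ?thesis
      using isoD(8)[OF q, of "chr q w u" v] isoD(8)[OF q, of u "chr q w v"]
        metric_linear(5)[of "\<phi> q" "d\<phi> q u" "chr (\<phi> q) (d\<phi> q w) (d\<phi> q v)"]
        metric_linear(5)[of "\<phi> q" "d\<phi> q u" "d2\<phi> q w v"]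
        metric_linear(5)[of "\<phi> q" "d\<phi> q u" "d\<phi> q (chr q w v)"]
      unfolding t_def T_def metric_linear(1-4) by linarith
  qed
  moreover have "t w u v = t u w v" for w u v
    by (simp only: t_def T_def d2\<phi>_commute[OF q, of w u] chr_commute[of _ "d\<phi> q w"] chr_commute[of _ w])
  \<comment> \<open>Six swaps, alternately of the last two and of the first two slots, return to the
    initial order with the opposite sign.\<close>
  ultimately have "t w u v = 0" for u v w by (smt (verit))
  then have "metric M (\<phi> q) (T w u) v = metric M (\<phi> q) 0 v" for v
    using \<psi>(2)[OF q, of v] unfolding t_def by (metis diff_self metric_linear(3))
  then have "T w u = 0" by (rule metric_nondegenerate[OF U_I(2)[OF q]])
  then show ?thesis unfolding T_def by (simp add: algebra_simps)
qed

lemma d3\<phi>_eq: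
  assumes q: "q \<in> U"
  shows "d3\<phi> q s w u = d2\<phi> q s (chr q w u) + d\<phi> q (s $ 2 *\<^sub>R chr' q w u)
    - (d\<phi> q s $ 2 *\<^sub>R chr' (\<phi> q) (d\<phi> q w) (d\<phi> q u) + chr (\<phi> q) (d2\<phi> q s w) (d\<phi> q u)
      + chr (\<phi> q) (d\<phi> q w) (d2\<phi> q s u))"
proof -
  define k where "k q = chr q w u" for q
  have k: "(k has_derivative (\<lambda>s. s $ 2 *\<^sub>R chr' q w u)) (at q)"
    using has_derivative_chr[OF U_I(1)[OF q] has_derivative_ident has_derivative_const has_derivative_const, of w u]
    linear_0[OF linear_chr(1)] linear_0[OF linear_chr(2)]
    by (simp add: k_def[abs_def])
  have expand: "L v = (\<Sum>i\<in>UNIV. v $ i *\<^sub>R L (axis i 1))" if "linear L" for L :: "real^4 \<Rightarrow> real^4" and v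
    using linear_sum[OF that, of "\<lambda>i. v $ i *\<^sub>R axis i 1" UNIV] linear_cmul[OF that] basis_expansion[of v]
    by (simp add: scalar_mult_eq_scaleR)
  \<comment> \<open>In \<open>d\<phi> q (k q)\<close> the argument moves along with
    \<open>q\<close>, so it is expanded in the standard basis before being differentiated.\<close>
  have "((\<lambda>q. \<Sum>i\<in>UNIV. k q $ i *\<^sub>R d\<phi> q (axis i 1)) has_derivative
      (\<lambda>s. \<Sum>i\<in>UNIV. k q $ i *\<^sub>R d2\<phi> q s (axis i 1) + (s $ 2 *\<^sub>R chr' q w u) $ i *\<^sub>R d\<phi> q (axis i 1))) (at q)"
    by (intro has_derivative_sum has_derivative_scaleR has_derivative_vec_nth k has_derivative_\<phi>(2)[OF q])
  also have "(\<lambda>s. \<Sum>i\<in>UNIV. k q $ i *\<^sub>R d2\<phi> q s (axis i 1) + (s $ 2 *\<^sub>R chr' q w u) $ i *\<^sub>R d\<phi> q (axis i 1)) =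
      (\<lambda>s. d2\<phi> q s (k q) + d\<phi> q (s $ 2 *\<^sub>R chr' q w u))"
  proof
    fix s
    show "(\<Sum>i\<in>UNIV. k q $ i *\<^sub>R d2\<phi> q s (axis i 1) + (s $ 2 *\<^sub>R chr' q w u) $ i *\<^sub>R d\<phi> q (axis i 1)) =
        d2\<phi> q s (k q) + d\<phi> q (s $ 2 *\<^sub>R chr' q w u)"
      unfolding sum.distrib
      by (intro arg_cong2[where f = "(+)"] expand[symmetric] linear_d2\<phi> linear_d\<phi> q)
  qed
  finally have "((\<lambda>q. d\<phi> q (k q)) has_derivative (\<lambda>s. d2\<phi> q s (k q) + d\<phi> q (s $ 2 *\<^sub>R chr' q w u))) (at q)"
    by (rule has_derivative_transform_within_open[OF _ isoD(1) q]) (rule expand[OF linear_d\<phi>, symmetric])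
  from has_derivative_diff[OF this has_derivative_chr[OF U_I(2)[OF q] has_derivative_\<phi>(1)[OF q]
        has_derivative_\<phi>(2)[OF q, of w] has_derivative_\<phi>(2)[OF q, of u]]]
  have "((\<lambda>q. d2\<phi> q w u) has_derivative (\<lambda>s. d2\<phi> q s (k q) + d\<phi> q (s $ 2 *\<^sub>R chr' q w u)
    - (d\<phi> q s $ 2 *\<^sub>R chr' (\<phi> q) (d\<phi> q w) (d\<phi> q u) + chr (\<phi> q) (d2\<phi> q s w) (d\<phi> q u)
      + chr (\<phi> q) (d\<phi> q w) (d2\<phi> q s u)))) (at q)"
    by (rule has_derivative_transform_within_open[OF _ isoD(1) q]) (simp add: d2\<phi>_eq k_def)
  from has_derivative_unique[OF this has_derivative_\<phi>(3)[OF q]] show ?thesis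
    unfolding k_def by metis
qed

text \<open>The integrability condition of \<open>d2\<phi>_eq\<close>: the third derivative of
  \<phi> is symmetric in \<open>s\<close> and \<open>w\<close>, and once all second derivatives are
  expressed by \<open>chr\<close>, its antisymmetric part is the difference of the two
  sides.\<close>

lemma riem_\<phi>:
  assumes q: "q \<in> U"
  shows "riem (\<phi> q) (d\<phi> q s) (d\<phi> q w) (d\<phi> q u) = d\<phi> q (riem q s w u)"
proof -
  note L = linear_diff[OF linear_d\<phi>[OF q]] linear_add[OF linear_d\<phi>[OF q]]
    linear_diff[OF linear_chr(1)] linear_diff[OF linear_chr(2)]
  show ?thesis
    using d3\<phi>_commute[OF q, where s = s and w = w and u = u] unfolding d3\<phi>_eq[OF q] d2\<phi>_eq[OF q] riem_def L
      chr_commute[of q w s] chr_commute[of "\<phi> q" "d\<phi> q w" "d\<phi> q s"]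
    by (simp add: algebra_simps)
qed

lemma linear_riem: "linear (\<lambda>s. riem p s w u)"
  unfolding riem_def
  by (rule linearI)
    (simp_all add: linear_add[OF linear_chr(1)] linear_add[OF linear_chr(2)] linear_cmul[OF linear_chr(1)]
      linear_cmul[OF linear_chr(2)] linear_add[OF linear_chr'(2)] linear_cmul[OF linear_chr'(2)] algebra_simps)

lemma ric_\<phi>:
  assumes q: "q \<in> U"
  shows "ric (\<phi> q) (d\<phi> q w) (d\<phi> q u) = ric q w u"
  unfolding ric_def
  by (rule trace_similar[symmetric, where f = "\<lambda>s. riem q s w u" and g = "\<lambda>s. riem (\<phi> q) s (d\<phi> q w) (d\<phi> q u)"
        and J = "d\<phi> q" and K = "\<psi> q"])
    (simp_all only: linear_riem linear_d\<phi>[OF q] linear_\<psi>[OF q] \<psi>(1)[OF q] riem_\<phi>[OF q])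

lemma ricop_\<phi>:
  assumes q: "q \<in> U"
  shows "ricop (\<phi> q) (d\<phi> q w) = d\<phi> q (ricop q w)"
proof (rule metric_nondegenerate[OF U_I(2)[OF q]])
  fix v
  show "metric M (\<phi> q) (ricop (\<phi> q) (d\<phi> q w)) v = metric M (\<phi> q) (d\<phi> q (ricop q w)) v"
    using metric_ricop[OF U_I(2)[OF q], of "d\<phi> q w" v] metric_ricop[OF U_I(1)[OF q], of w "\<psi> q v"]
      isoD(8)[OF q, of "ricop q w" "\<psi> q v"] ric_\<phi>[OF q, of w "\<psi> q v"]
    unfolding \<psi>(2)[OF q] by (elim trans[OF _ sym] trans) (rule refl)
qed

lemma scalar_\<phi>:
  assumes q: "q \<in> U"
  shows "\<alpha> (\<phi> q $ 2) - 2 * \<beta> (\<phi> q $ 2) = \<alpha> (q $ 2) - 2 * \<beta> (q $ 2)"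
  using trace_similar[OF linear_ricop linear_ricop linear_d\<phi>[OF q] linear_\<psi>[OF q] \<psi>(1)[OF q] ricop_\<phi>[OF q]]
  by (simp add: trace_ricop U_I q)

text \<open>At \<open>\<phi> q\<close> the coordinate vector along x is an eigenvector of
  \<open>ricop\<close> for \<open>l\<close>; its preimage is one at \<open>q\<close>, so
  \<open>l\<close> belongs to the spectrum there. The alternatives are the direction of z, the
  direction of x and the characteristic equation of the remaining block; which of them occurs stays
  open.\<close>

lemma eigenvalue_\<phi>:
  assumes q: "q \<in> U"
  defines "l \<equiv> - \<beta> (\<phi> q $ 2)"
  shows "l = 0 \<or> l = - \<beta> (q $ 2) \<or> (\<alpha> (q $ 2) - l) * (\<beta> (q $ 2) + l) - (\<delta> (q $ 2))\<^sup>2 = 0"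
proof -
  let ?x = "q $ 2"
  define v where "v = \<psi> q (axis 2 1)"
  have v: "d\<phi> q v = axis 2 1" unfolding v_def by (rule \<psi>(2)[OF q])
  have "d\<phi> q (ricop q v) = ricop (\<phi> q) (axis 2 1)" using ricop_\<phi>[OF q, of v] v by simp
  also have "\<dots> = l *\<^sub>R axis 2 1" by (simp add: ricop_def l_def vec4_eq_iff Let_def axis_def)
  also have "\<dots> = d\<phi> q (l *\<^sub>R v)" using linear_cmul[OF linear_d\<phi>[OF q]] v by simp
  finally have e: "ricop q v = l *\<^sub>R v" using \<psi>(1)[OF q] by metis
  have "v \<noteq> 0"
  proof
    assume "v = 0"
    then have "axis 2 1 = (0::real^4)" using v linear_0[OF linear_d\<phi>[OF q]] by simp
    then show False by simp
  qed
  define a b where "a = v $ 1 + H ?x * v $ 3" and "b = D ?x * v $ 3"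
  have D: "D ?x \<noteq> 0" using D_nz U_I q by auto
  have e4: "0 = l * v $ 4" and e2: "- \<beta> ?x * v $ 2 = l * v $ 2"
    and e3: "- \<delta> ?x * a / D ?x - \<beta> ?x * v $ 3 = l * v $ 3"
    and e1: "\<alpha> ?x * a + \<delta> ?x * D ?x * v $ 3 - H ?x * (- \<delta> ?x * a / D ?x - \<beta> ?x * v $ 3) = l * v $ 1"
    using e[unfolded ricop_def Let_def vec4_eq_iff vec4_nth vector_scaleR_component real_scaleR_def, folded a_def]
    by blast+
  have eb: "- \<delta> ?x * a - \<beta> ?x * b = l * b"
    using e3 D by (simp add: b_def field_simps)
  have ea: "\<alpha> ?x * a + \<delta> ?x * b = l * a"
    using e1[unfolded e3] a_def b_def by algebra
  have "a \<noteq> 0 \<or> b \<noteq> 0 \<or> v $ 2 \<noteq> 0 \<or> v $ 4 \<noteq> 0"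
    using \<open>v \<noteq> 0\<close> D by (auto simp: vec4_eq_iff a_def b_def)
  moreover have "((\<alpha> ?x - l) * (\<beta> ?x + l) - (\<delta> ?x)\<^sup>2) * a = 0" "((\<alpha> ?x - l) * (\<beta> ?x + l) - (\<delta> ?x)\<^sup>2) * b = 0"
    using ea eb by algebra+
  moreover have "(l + \<beta> ?x) * v $ 2 = 0" using e2 by (simp add: algebra_simps)
  ultimately show ?thesis using e4 by (auto simp: eq_neg_iff_add_eq_0)
qed

text \<open>The torsion sends the frame vectors along dx and D dy to \<open>S\<close> times the unit
  vector along t. The images of these two vectors may acquire a component along z, which shrinks the
  area \<open>c\<close> that the torsion at \<open>q\<close> sees. Hence only an inequality;
  applying it to the inverse of an isometry gives the converse.\<close>

lemma torsion_scalar_le: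
  assumes pts: "p \<in> points M" "q \<in> points M" and L: "linear L"
    and g: "\<And>u v. metric M q (L u) (L v) = metric M p u v"
    and T: "\<And>u v. torsion M q (L u) (L v) = L (torsion M p u v)"
  shows "\<bar>S (p $ 4)\<bar> \<le> \<bar>S (q $ 4)\<bar>"
proof (cases "S (p $ 4) = 0")
  case False
  have D: "D (p $ 2) \<noteq> 0" using pts D_nz by auto
  \<comment> \<open>The unit vector dual to D dy, orthogonal to the direction of t.\<close>
  define e where "e = vec4 (- H (p $ 2) / D (p $ 2)) 0 (1 / D (p $ 2)) 0"
  define a b where "a = L (axis 2 1)" and "b = L e"
  define n where "n = L (axis 1 1)"
  define c where "c = a $ 2 * (D (q $ 2) * b $ 3) - (D (q $ 2) * a $ 3) * b $ 2"
  have ax: "axis 1 1 = vec4 1 0 0 0" "axis 2 1 = vec4 0 1 0 0"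
    by (simp_all add: vec4_def)
  have "torsion M p (axis 2 1) e = S (p $ 4) *\<^sub>R axis 1 1"
    using D by (simp add: ax e_def vec4_eq_iff)
  then have "L (torsion M p (axis 2 1) e) = S (p $ 4) *\<^sub>R n"
    by (simp only: linear_cmul[OF L] n_def)
  then have n: "S (p $ 4) *\<^sub>R n = vec4 (S (q $ 4) * c) 0 0 0"
    using T[of "axis 2 1" e] by (simp add: a_def b_def c_def algebra_simps)
  then have n': "n $ 2 = 0" "n $ 3 = 0" "n $ 4 = 0" "S (p $ 4) * n $ 1 = S (q $ 4) * c"
    using False by (auto simp: vec4_eq_iff)
  have "n $ 1 * n $ 1 = 1"
    using g[of "axis 1 1" "axis 1 1", folded n_def] n' by (simp add: ax)
  then have n1: "\<bar>n $ 1\<bar> = 1" "n $ 1 \<noteq> 0" by (auto simp: square_eq_1_iff)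
  \<comment> \<open>The torsion takes values along t only, so \<open>n\<close> lies in that
    direction; \<open>a\<close> and \<open>b\<close>, being orthogonal to \<open>n\<close>, are
    purely spatial.\<close>
  have "a $ 1 + H (q $ 2) * a $ 3 = 0" "b $ 1 + H (q $ 2) * b $ 3 = 0"
    using g[of "axis 2 1" "axis 1 1", folded a_def n_def] g[of e "axis 1 1", folded b_def n_def] n' n1(2) D
    by (simp_all add: ax e_def)
  then have "(D (q $ 2) * a $ 3)\<^sup>2 + (a $ 2)\<^sup>2 + (a $ 4)\<^sup>2 = 1" "(D (q $ 2) * b $ 3)\<^sup>2 + (b $ 2)\<^sup>2 + (b $ 4)\<^sup>2 = 1"
    using g[of "axis 2 1" "axis 2 1", folded a_def] g[of e e, folded b_def] D
    by (simp_all add: ax e_def power2_eq_square algebra_simps)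
  then have "(D (q $ 2) * a $ 3)\<^sup>2 + (a $ 2)\<^sup>2 \<le> 1" "(D (q $ 2) * b $ 3)\<^sup>2 + (b $ 2)\<^sup>2 \<le> 1"
    by (smt (verit) zero_le_power2)+
  then have "((D (q $ 2) * a $ 3)\<^sup>2 + (a $ 2)\<^sup>2) * ((D (q $ 2) * b $ 3)\<^sup>2 + (b $ 2)\<^sup>2) \<le> 1 * 1"
    by (intro mult_mono) auto
  \<comment> \<open>Lagrange's identity for the projections of \<open>a\<close> and \<open>b\<close>
    to the plane of dx and D dy, both of length at most 1.\<close>
  moreover have "((D (q $ 2) * a $ 3)\<^sup>2 + (a $ 2)\<^sup>2) * ((D (q $ 2) * b $ 3)\<^sup>2 + (b $ 2)\<^sup>2) =
      c\<^sup>2 + (D (q $ 2) * a $ 3 * (D (q $ 2) * b $ 3) + a $ 2 * b $ 2)\<^sup>2"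
    unfolding c_def by algebra
  ultimately have "c\<^sup>2 \<le> 1" by (smt (verit) zero_le_power2)
  then have "\<bar>c\<bar> \<le> 1" by (simp add: abs_square_le_1)
  have "\<bar>S (p $ 4)\<bar> = \<bar>S (q $ 4)\<bar> * \<bar>c\<bar>"
    using arg_cong[OF n'(4), of abs] n1(1) by (simp add: abs_mult)
  also have "\<dots> \<le> \<bar>S (q $ 4)\<bar>" using \<open>\<bar>c\<bar> \<le> 1\<close> by (simp add: mult_left_le)
  finally show ?thesis .
qed simp

lemma torsion_scalar_\<phi>:
  assumes q: "q \<in> U"
  shows "\<bar>S (\<phi> q $ 4)\<bar> = \<bar>S (q $ 4)\<bar>"
proof (rule antisym)
  have pts: "q \<in> points M" "\<phi> q \<in> points M"
    using isoD(2,4) bij_betwE[OF isoD(5)] q by blast+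
  show "\<bar>S (q $ 4)\<bar> \<le> \<bar>S (\<phi> q $ 4)\<bar>"
    by (rule torsion_scalar_le[OF pts linear_d\<phi>[OF q] isoD(8)[OF q] isoD(9)[OF q]])
  show "\<bar>S (\<phi> q $ 4)\<bar> \<le> \<bar>S (q $ 4)\<bar>"
  proof (rule torsion_scalar_le[OF pts(2,1) linear_\<psi>[OF q]])
    show "metric M q (\<psi> q u) (\<psi> q v) = metric M (\<phi> q) u v" for u v
      using isoD(8)[OF q, of "\<psi> q u" "\<psi> q v"] by (simp only: \<psi>(2)[OF q])
    show "torsion M q (\<psi> q u) (\<psi> q v) = \<psi> q (torsion M (\<phi> q) u v)" for u v
      using isoD(9)[OF q, of "\<psi> q u" "\<psi> q v"] \<psi>(1)[OF q] unfolding \<psi>(2)[OF q] by metis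
  qed
qed

end

lemma continuous_finite_image_constant:
  fixes f :: "real \<Rightarrow> real"
  assumes "connected A" "continuous_on A f" "finite (f ` A)" "a \<in> A" "b \<in> A"
  shows "f a = f b"
  using continuous_finite_range_constant[OF assms(1-3)] assms(4,5) unfolding constant_on_def by metis

section \<open>From open orbits to constant parameters\<close>

context goedel
begin

lemma mem_motion_orbit:
  assumes "p \<in> points M"
  shows "p \<in> motion_orbit M p"
proof -
  have op: "open (points M)" using open_points[OF I(1) J(1)] by simp
  have "inv_into (points M) (\<lambda>x. x) y = y" if "y \<in> points M" for y
    using inv_into_f_f[of "\<lambda>x. x" "points M" y] that by simp
  then have "smooth_on (points M) (inv_into (points M) (\<lambda>x. x))"
    using smooth_on_cong[OF op] smooth_on_id[OF op] by (metis (no_types, lifting))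
  then have "local_affine_isometry M M (points M) (points M) (\<lambda>x. x)"
    unfolding local_affine_isometry_def Let_def
    using op smooth_on_id[OF op] by (auto simp: bij_betw_def frechet_derivative_ident)
  with assms show ?thesis unfolding motion_orbit_def mem_Collect_eq
    by (intro exI[of _ "points M"] exI[of _ "\<lambda>x. x"]) simp
qed

lemma motion_orbit_eventually:
  assumes hom: "locally_homogeneous M" and c: "c x \<in> points M" "isCont c (x::real)"
  shows "\<forall>\<^sub>F y in at x within A. c y \<in> motion_orbit M (c x)"
proof -
  have "open (motion_orbit M (c x))" "c x \<in> motion_orbit M (c x)"
    using hom c(1) mem_motion_orbit unfolding locally_homogeneous_def by blast+
  then have "\<forall>\<^sub>F y in at x. c y \<in> motion_orbit M (c x)"
    using c(2) unfolding continuous_at by (metis topological_tendstoD)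
  then show ?thesis using eventually_at_topological by (auto simp: eventually_at)
qed

lemma motion_orbit_invariants:
  assumes "q \<in> motion_orbit M p"
  shows "\<alpha> (q $ 2) - 2 * \<beta> (q $ 2) = \<alpha> (p $ 2) - 2 * \<beta> (p $ 2)" and "\<bar>S (q $ 4)\<bar> = \<bar>S (p $ 4)\<bar>"
    and "- \<beta> (q $ 2) = 0 \<or> - \<beta> (q $ 2) = - \<beta> (p $ 2) \<or>
      (\<alpha> (p $ 2) - (- \<beta> (q $ 2))) * (\<beta> (p $ 2) + (- \<beta> (q $ 2))) - (\<delta> (p $ 2))\<^sup>2 = 0"
proof -
  obtain U V \<phi> where *: "local_affine_isometry M M U V \<phi>" "p \<in> U" "q = \<phi> p"
    using assms unfolding motion_orbit_def by blast
  interpret goedel_isometry I J H D S U V \<phi> by unfold_locales (rule *(1))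
  show "\<alpha> (q $ 2) - 2 * \<beta> (q $ 2) = \<alpha> (p $ 2) - 2 * \<beta> (p $ 2)" "\<bar>S (q $ 4)\<bar> = \<bar>S (p $ 4)\<bar>"
    "- \<beta> (q $ 2) = 0 \<or> - \<beta> (q $ 2) = - \<beta> (p $ 2) \<or>
      (\<alpha> (p $ 2) - (- \<beta> (q $ 2))) * (\<beta> (p $ 2) + (- \<beta> (q $ 2))) - (\<delta> (p $ 2))\<^sup>2 = 0"
    using scalar_\<phi>[OF *(2)] torsion_scalar_\<phi>[OF *(2)] eigenvalue_\<phi>[OF *(2)] unfolding *(3) by blast+
qed

lemma constant_if_abs_constant:
  fixes f :: "real \<Rightarrow> real"
  assumes "is_interval A" "continuous_on A f" "\<And>x. x \<in> A \<Longrightarrow> \<bar>f x\<bar> = c"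
  obtains k where "\<And>x. x \<in> A \<Longrightarrow> f x = k"
proof -
  have "f x = c \<or> f x = - c" if "x \<in> A" for x using assms(3)[OF that] by linarith
  then have "f ` A \<subseteq> {c, - c}" by auto
  then have "finite (f ` A)" by (rule finite_subset) auto
  then show ?thesis
    using that continuous_finite_image_constant[OF is_interval_connected[OF assms(1)] assms(2)] by metis
qed

text \<open>
  Isometries preserve \<open>\<bar>S\<bar>\<close>, the scalar curvature \<open>\<alpha> - 2 \<beta>\<close> and the spectrum of the
  Ricci operator, which contains \<open>- \<beta>\<close>. The eigenvalue \<open>- \<beta>\<close> may change along an orbit, but only
  within a finite set, so that continuity makes it constant.
\<close>

lemma locally_homogeneous_parameters:
  assumes hom: "locally_homogeneous M"
  shows "\<exists>m2 \<omega> S0. goedel_parameters I J H D S m2 \<omega> S0"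
proof -
  obtain x0 z0 where x0: "x0 \<in> I" and z0: "z0 \<in> J" using I J by blast
  \<comment> \<open>Curves along x and along z suffice, because each invariant depends on just one
    of these coordinates.\<close>
  have cont: "isCont (\<lambda>y. vec4 0 y 0 z0) y" "isCont (\<lambda>y. vec4 0 x0 0 y) y" for y
    unfolding vec4_def by (intro continuous_intros)+
  have evI: "\<forall>\<^sub>F y in at x within A. vec4 0 y 0 z0 \<in> motion_orbit M (vec4 0 x 0 z0)" if "x \<in> I" for x A
    by (rule motion_orbit_eventually[OF hom _ cont(1)]) (use that z0 in simp)
  have evJ: "\<forall>\<^sub>F y in at z within A. vec4 0 x0 0 y \<in> motion_orbit M (vec4 0 x0 0 z)" if "z \<in> J" for z A
    by (rule motion_orbit_eventually[OF hom _ cont(2)]) (use that x0 in simp)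
  have "\<forall>\<^sub>F y in at x within I. \<alpha> x - 2 * \<beta> x = \<alpha> y - 2 * \<beta> y" if "x \<in> I" for x
    using evI[OF that] by eventually_elim (auto dest: motion_orbit_invariants(1))
  then have scal: "\<alpha> x - 2 * \<beta> x = \<alpha> x0 - 2 * \<beta> x0" if "x \<in> I" for x
    using connected_local_const[OF is_interval_connected[OF I(2)] that x0, of "\<lambda>x. \<alpha> x - 2 * \<beta> x"] by blast
  have "\<forall>\<^sub>F z' in at z within J. \<bar>S z\<bar> = \<bar>S z'\<bar>" if "z \<in> J" for z
    using evJ[OF that] by eventually_elim (auto dest: motion_orbit_invariants(2))
  then have absS: "\<bar>S z\<bar> = \<bar>S z0\<bar>" if "z \<in> J" for z
    using connected_local_const[OF is_interval_connected[OF J(2)] that z0, of "\<lambda>z. \<bar>S z\<bar>"] by blast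
  obtain S0 where S0: "\<And>z. z \<in> J \<Longrightarrow> S z = S0"
    using constant_if_abs_constant[OF J(2) smooth_on_continuous_on[OF smooth(3)] absS] by blast
  have c\<beta>: "continuous_on I \<beta>"
    unfolding \<beta>_def[abs_def] \<alpha>_def
    by (intro continuous_intros smooth_on_continuous_on[OF smooth1(1)] smooth_on_continuous_on[OF smooth(2)]
        smooth_on_continuous_on[OF smooth2(2)]) (use D_nz in auto)
  have "\<forall>\<^sub>F y in at x within I. \<beta> x = \<beta> y" if x: "x \<in> I" for x
  proof -
    have "\<forall>\<^sub>F y in at x. y \<in> I" using I(1) x by (simp add: eventually_at_in_open')
    with evI[OF x] have "\<forall>\<^sub>F y in at x. vec4 0 y 0 z0 \<in> motion_orbit M (vec4 0 x 0 z0) \<and> y \<in> I"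
      by (rule eventually_conj)
    then obtain e where e: "e > 0" "\<And>y. dist y x < e \<Longrightarrow> y \<noteq> x \<Longrightarrow>
        vec4 0 y 0 z0 \<in> motion_orbit M (vec4 0 x 0 z0) \<and> y \<in> I"
      unfolding eventually_at by auto
    have "vec4 0 x 0 z0 \<in> motion_orbit M (vec4 0 x 0 z0)"
      by (rule mem_motion_orbit) (use x z0 in simp)
    then have orb: "vec4 0 y 0 z0 \<in> motion_orbit M (vec4 0 x 0 z0)" "y \<in> I" if "y \<in> ball x e" for y
      using e(2)[of y] that x by (cases "y = x"; auto simp: dist_commute)+
    \<comment> \<open>Up to sign, the characteristic polynomial of the two-dimensional block of the
      Ricci operator at \<open>x\<close>. Its leading coefficient - 1 ensures finitely many roots,
      whatever the other coefficients are.\<close>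
    let ?P = "[:\<alpha> x * \<beta> x - (\<delta> x)\<^sup>2, \<alpha> x - \<beta> x, - 1:]"
    have "- \<beta> y \<in> {0, - \<beta> x} \<union> {l. poly ?P l = 0}" if "y \<in> ball x e" for y
      using motion_orbit_invariants(3)[OF orb(1)[OF that]]
      by (simp only: vec4_nth) (auto simp: algebra_simps power2_eq_square)
    then have "- \<beta> y \<in> {0, - \<beta> x} \<union> {l. poly ?P l = 0} \<and> \<beta> y = - (- \<beta> y)" if "y \<in> ball x e" for y
      using that by (simp only: minus_minus)
    then have "\<beta> ` ball x e \<subseteq> uminus ` ({0, - \<beta> x} \<union> {l. poly ?P l = 0})"
      by (intro image_subsetI) (blast intro: image_eqI)
    moreover have "finite {l. poly ?P l = 0}" by (rule poly_roots_finite) simp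
    ultimately have "finite (\<beta> ` ball x e)" by (meson finite_UnI finite_imageI finite_insert finite.emptyI finite_subset)
    moreover have "continuous_on (ball x e) \<beta>" using continuous_on_subset[OF c\<beta>] orb(2) by blast
    ultimately have "\<beta> x = \<beta> y" if "y \<in> ball x e" for y
      using continuous_finite_image_constant[OF connected_ball, of x e \<beta> x y] that e(1) by auto
    then show ?thesis unfolding eventually_at using e(1) by (auto simp: dist_commute)
  qed
  then have \<beta>: "\<beta> x = \<beta> x0" if "x \<in> I" for x
    using connected_local_const[OF is_interval_connected[OF I(2)] that x0, of \<beta>] by blast
  have \<alpha>: "\<alpha> x = \<alpha> x0" if "x \<in> I" for x using scal[OF that] \<beta>[OF that] by simp
  \<comment> \<open>\<alpha> is half the square of H' / D, so its constancy fixes the absolute value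
    only.\<close>
  have abs: "\<bar>H1 x / D x\<bar> = sqrt (2 * \<alpha> x0)" if "x \<in> I" for x
    using \<alpha>[OF that] by (simp add: \<alpha>_def[of x] flip: real_sqrt_abs)
  have cont: "continuous_on I (\<lambda>x. H1 x / D x)"
    by (intro continuous_intros smooth_on_continuous_on[OF smooth1(1)] smooth_on_continuous_on[OF smooth(2)])
      (use D_nz in auto)
  obtain \<Omega> where \<Omega>: "\<And>x. x \<in> I \<Longrightarrow> H1 x / D x = \<Omega>"
    using constant_if_abs_constant[OF I(2) cont abs] by blast
  have "goedel_parameters I J H D S (\<alpha> x0 - \<beta> x0) (\<Omega> / 2) S0"
    unfolding goedel_parameters_def
  proof (intro conjI ballI)
    show "D2 x / D x = \<alpha> x0 - \<beta> x0" if "x \<in> I" for x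
      using \<alpha>[OF that] \<beta>[OF that] by (simp add: \<beta>_def)
  qed (use \<Omega> S0 in auto)
  then show ?thesis by blast
qed

lemma goedel_constantI:
  assumes "goedel_parameters I J H D S m2 \<omega> S0"
  shows "goedel_constant I J H D S D1 m2 (2 * \<omega>) S0"
proof
  note par = assms[unfolded goedel_parameters_def]
  fix x assume x: "x \<in> I"
  show "D x \<noteq> 0" "(D has_real_derivative D1 x) (at x)"
    using D_nz DERIV(2) x by auto
  show "(D1 has_real_derivative m2 * D x) (at x)" "(H has_real_derivative 2 * \<omega> * D x) (at x)"
    using DERIV(1,4)[OF x] par x D_nz[OF x] by (auto simp: field_simps)
next
  show "S z = S0" if "z \<in> J" for z using assms that by (simp add: goedel_parameters_def)
qed (use I J smooth smooth1 in auto)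

end

text \<open>Independence of the parameters means that every triad occurs. \<open>D\<close> is the
  solution of D'' = m2 D with D(0) = 1 and D'(0) = 0, on an interval about 0 where it stays
  positive, and \<open>H\<close> is \<open>2 * \<omega>\<close> times its primitive.\<close>

lemma goedel_example:
  obtains I J H D S where "goedel_data I J H D S" "goedel_parameters I J H D S m2 \<omega> S0"
proof -
  have "isCont (cosk m2) 0" by (rule DERIV_isCont[OF DERIV_cosk])
  then have "\<forall>\<^sub>F x in at 0. cosk m2 x > 0"
    using order_tendstoD(1)[of "cosk m2" "cosk m2 0" "at 0" 0] by (simp add: isCont_def)
  then obtain e where e: "e > 0" "\<And>x. x \<noteq> 0 \<Longrightarrow> dist x 0 < e \<Longrightarrow> cosk m2 x > 0"
    unfolding eventually_at by auto
  have pos: "cosk m2 x > 0" if "x \<in> ball 0 e" for x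
    using e(2)[of x] that by (cases "x = 0") auto
  have d: "deriv (cosk m2) = (\<lambda>x. m2 * sink m2 x)" "deriv (\<lambda>x. m2 * sink m2 x) = (\<lambda>x. m2 * cosk m2 x)"
    "deriv (\<lambda>x. 2 * \<omega> * sink m2 x) = (\<lambda>x. 2 * \<omega> * cosk m2 x)"
    by (auto intro!: ext DERIV_imp_deriv derivative_eq_intros DERIV_cosk DERIV_sink)
  have "goedel_data (ball 0 e) UNIV (\<lambda>x. 2 * \<omega> * sink m2 x) (cosk m2) (\<lambda>z. S0)"
    unfolding goedel_data_def open_interval_def
    using e(1) pos smooth_on_subset[OF smooth_on_cosk_sink(1)]
    by (auto simp: is_interval_ball_real less_imp_neq intro!: smooth_intros) (metis less_irrefl)+
  moreover have "goedel_parameters (ball 0 e) UNIV (\<lambda>x. 2 * \<omega> * sink m2 x) (cosk m2) (\<lambda>z. S0) m2 \<omega> S0"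
    unfolding goedel_parameters_def d using pos by force
  ultimately show ?thesis by (rule that)
qed

theorem theorem2:
  shows
    "(\<forall>I J H D S.
        goedel_data I J H D S \<and> locally_homogeneous (goedel_rc I J H D S) \<longrightarrow>
          admits_motion_group (goedel_rc I J H D S) 5 \<and>
          (\<exists>m2 \<omega> S0. goedel_parameters I J H D S m2 \<omega> S0)) \<and>
     (\<forall>I J H D S I' J' H' D' S' m2 \<omega> S0.
        goedel_data I J H D S \<and> locally_homogeneous (goedel_rc I J H D S) \<and>
        goedel_data I' J' H' D' S' \<and> locally_homogeneous (goedel_rc I' J' H' D' S') \<and>
        goedel_parameters I J H D S m2 \<omega> S0 \<and> goedel_parameters I' J' H' D' S' m2 \<omega> S0 \<longrightarrow>
          locally_equivalent (goedel_rc I J H D S) (goedel_rc I' J' H' D' S')) \<and>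
     (\<forall>m2 \<omega> S0. \<exists>I J H D S.
        goedel_data I J H D S \<and> locally_homogeneous (goedel_rc I J H D S) \<and>
        goedel_parameters I J H D S m2 \<omega> S0)"
proof (intro conjI allI impI; (elim conjE)?)
  fix I J H D S
  assume "goedel_data I J H D S" and hom: "locally_homogeneous (goedel_rc I J H D S)"
  then interpret goedel I J H D S by unfold_locales
  show par: "\<exists>m2 \<omega> S0. goedel_parameters I J H D S m2 \<omega> S0"
    by (rule locally_homogeneous_parameters[OF hom])
  show "admits_motion_group (goedel_rc I J H D S) 5"
    using par goedel_constantI goedel_constant.admits_motion_group_5 by blast
next
  fix I J H D S I' J' H' D' S' m2 \<omega> S0
  let ?M = "goedel_rc I J H D S" and ?N = "goedel_rc I' J' H' D' S'"
  assume data: "goedel_data I J H D S" "goedel_data I' J' H' D' S'"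
    and par: "goedel_parameters I J H D S m2 \<omega> S0" "goedel_parameters I' J' H' D' S' m2 \<omega> S0"
  interpret M: goedel I J H D S by unfold_locales (rule data)
  interpret N: goedel I' J' H' D' S' by unfold_locales (rule data)
  note trans = goedel_constant_transitive[OF M.goedel_constantI[OF par(1)] N.goedel_constantI[OF par(2)]]
  have ne: "vec4 0 x 0 z \<in> points ?M" if "x \<in> I" "z \<in> J" for x z using that by simp
  have ne': "vec4 0 x 0 z \<in> points ?N" if "x \<in> I'" "z \<in> J'" for x z using that by simp
  \<comment> \<open>Local equivalence leaves the partner of a point free, so one fixed point on each
    side will do.\<close>
  obtain p0 q0 where p0: "p0 \<in> points ?M" and q0: "q0 \<in> points ?N"
    using ne ne' M.I(3) M.J(3) N.I(3) N.J(3) by blast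
  show "locally_equivalent ?M ?N"
    unfolding locally_equivalent_def
  proof (intro conjI ballI)
    fix p assume "p \<in> points ?M"
    from trans[OF this q0] show "\<exists>U V \<phi>. local_affine_isometry ?M ?N U V \<phi> \<and> p \<in> U" by metis
  next
    fix q assume "q \<in> points ?N"
    from trans[OF p0 this] obtain U V \<phi> where "local_affine_isometry ?M ?N U V \<phi>" "p0 \<in> U" "\<phi> p0 = q"
      by metis
    then show "\<exists>U V \<phi>. local_affine_isometry ?M ?N U V \<phi> \<and> q \<in> V"
      using local_affine_isometryD(5) bij_betwE by metis
  qed
next
  fix m2 \<omega> S0 :: real
  obtain I J H D S where "goedel_data I J H D S" and par: "goedel_parameters I J H D S m2 \<omega> S0"
    by (rule goedel_example)
  then interpret goedel I J H D S by unfold_locales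
  show "\<exists>I J H D S. goedel_data I J H D S \<and> locally_homogeneous (goedel_rc I J H D S) \<and>
      goedel_parameters I J H D S m2 \<omega> S0"
    using goedel_constant.locally_homogeneous[OF goedel_constantI[OF par]] par data by blast
qed

end
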